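(* Let $(M,d)$ be a complete pointed metric space and let $\nu$ be a positive Radon measure on $\beta\widetilde{M}$ with $\|\nu\|=\|\Phi^*\nu\|$. Then there exists a positive Radon measure $\mu$ on $\beta\widetilde{M}$ with $\|\mu\|=\|\Phi^*\mu\|$ such that: (i) $\Phi^*\mu=\Phi^*\nu$; (ii) if $\nu$ is concentrated on a set belonging to $\mathfrak{C}$, then so is $\mu$; (iii) if $\nu$ is concentrated on $\mathcal{R}\setminus\Delta(A)$ for a Borel set $A\subset\mathcal{R}(M)$, then $((p_1)_\sharp\mu)|_A\perp((p_2)_\sharp\mu)|_A$.
   Context: $\mathrm{Lip}_0(M)$: Lipschitz $f:M\to\mathbb{R}$ with $f(0)=0$ ($0$ the base point), normed by the Lipschitz constant. $\widetilde{M}=\{(x,y)\in M\times M:x\ne y\}$, $\beta\widetilde{M}$ its Stone–Čech compactification, Radon measures identified with $C(\beta\widetilde{M})^*$. $\Phi:\mathrm{Lip}_0(M)\to C(\beta\widetilde{M})$ maps $f$ to the continuous extension of $(x,y)\mapsto(f(x)-f(y))/d(x,y)$; $\Phi^*$ its adjoint. $d:\beta\widetilde{M}\to[0,\infty]$ is the continuous extension of the metric on $\widetilde{M}$. $M^u$ is the uniform (Samuel) compactification of $M$; $p_1,p_2:\beta\widetilde{M}\to M^u$ continuously extend the coordinate projections, $p=(p_1,p_2)$. $\mathcal{R}(M)=\{\xi\in M^u:\overline{d_0}(\xi)<\infty\}$ where $\overline{d_0}$ is the continuous extension of $x\mapsto d(x,0)$ to $M^u\to[0,\infty]$; $\mathcal{R}=p^{-1}(\mathcal{R}(M)\times\mathcal{R}(M))$.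 For Borel $A\subset\mathcal{R}(M)$, $\Delta(A)=d^{-1}(0)\cap p^{-1}(A\times A)$. $G$ is the set of $g\in C(\beta\widetilde{M})$ with $d(x,y)g(x,y)\le d(x,u)g(x,u)+d(u,y)g(u,y)$ for all distinct $x,u,y\in M$; for positive Radon measures, $\mu\preccurlyeq\nu$ iff $\int g\,d\mu\le\int g\,d\nu$ for all $g\in G$. $\mathfrak{C}$ is the family of Borel sets $C\subset\beta\widetilde{M}$ such that whenever $\mu,\nu$ are positive Radon measures, $\nu$ is concentrated on $C$ and $\mu\preccurlyeq\nu$, then $\mu$ is concentrated on $C$. Throughout, $M$ has at least three distinct points. *)

theory Defs
  imports "HOL-Analysis.Analysis"
begin

definition offdiag :: "('a \<times> 'a) set" where
  "offdiag = {(x, y). x \<noteq> y}"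

definition stone_cech_offdiag :: "('a::metric_space \<times> 'a \<Rightarrow> 'b::t2_space) \<Rightarrow> bool" where
  "stone_cech_offdiag e \<longleftrightarrow>
     compact (UNIV :: 'b set) \<and>
     (\<exists>g. homeomorphism offdiag (e ` offdiag) e g) \<and>
     closure (e ` offdiag) = UNIV \<and>
     (\<forall>f :: 'a \<times> 'a \<Rightarrow> real. continuous_on offdiag f \<and> bounded (f ` offdiag) \<longrightarrow>
        (\<exists>h. continuous_on UNIV h \<and> (\<forall>z\<in>offdiag. h (e z) = f z)))"

definition samuel_compactification :: "('a::metric_space \<Rightarrow> 'c::t2_space) \<Rightarrow> bool" where
  "samuel_compactification i \<longleftrightarrow>
     compact (UNIV :: 'c set) \<and>
     (\<exists>g. homeomorphism UNIV (range i) i g) \<and>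
     closure (range i) = UNIV \<and>
     (\<forall>f :: 'a \<Rightarrow> real. bounded (range f) \<longrightarrow>
        ((\<exists>h. continuous_on UNIV h \<and> h \<circ> i = f) \<longleftrightarrow> uniformly_continuous_on UNIV f))"

definition Lip0 :: "'a::metric_space \<Rightarrow> ('a \<Rightarrow> real) set" where
  "Lip0 z0 = {f. (\<exists>C. C-lipschitz_on UNIV f) \<and> f z0 = 0}"

definition Lip0_ball :: "'a::metric_space \<Rightarrow> ('a \<Rightarrow> real) set" where
  "Lip0_ball z0 = {f. 1-lipschitz_on UNIV f \<and> f z0 = 0}"

definition radon :: "'b::topological_space measure \<Rightarrow> bool" where
  "radon \<nu> \<longleftrightarrow> sets \<nu> = sets borel \<and> emeasure \<nu> (space \<nu>) < \<infinity> \<and>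
     (\<forall>A \<in> sets borel. emeasure \<nu> A = (SUP K \<in> {K. compact K \<and> K \<subseteq> A}. emeasure \<nu> K))"

definition mnorm :: "'b measure \<Rightarrow> real" where
  "mnorm \<nu> = measure \<nu> (space \<nu>)"

definition PhiStar_norm :: "'a::metric_space \<Rightarrow> (('a \<Rightarrow> real) \<Rightarrow> 'b \<Rightarrow> real) \<Rightarrow> 'b measure \<Rightarrow> real" where
  "PhiStar_norm z0 Phi \<nu> = Sup ((\<lambda>f. \<bar>integral\<^sup>L \<nu> (Phi f)\<bar>) ` Lip0_ball z0)"

definition concentrated_on :: "'b measure \<Rightarrow> 'b set \<Rightarrow> bool" where
  "concentrated_on \<nu> C \<longleftrightarrow> (\<exists>N \<in> sets \<nu>. space \<nu> - C \<subseteq> N \<and> emeasure \<nu> N = 0)"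

definition Gset :: "('a::metric_space \<times> 'a \<Rightarrow> 'b::topological_space) \<Rightarrow> ('b \<Rightarrow> real) set" where
  "Gset e = {g. continuous_on UNIV g \<and>
     (\<forall>x u y. x \<noteq> u \<and> u \<noteq> y \<and> x \<noteq> y \<longrightarrow>
        dist x y * g (e (x, y)) \<le> dist x u * g (e (x, u)) + dist u y * g (e (u, y)))}"

definition preceq :: "('a::metric_space \<times> 'a \<Rightarrow> 'b::topological_space) \<Rightarrow> 'b measure \<Rightarrow> 'b measure \<Rightarrow> bool" where
  "preceq e \<mu> \<nu> \<longleftrightarrow> (\<forall>g \<in> Gset e. integral\<^sup>L \<mu> g \<le> integral\<^sup>L \<nu> g)"

definition frakC :: "('a::metric_space \<times> 'a \<Rightarrow> 'b::topological_space) \<Rightarrow> 'b set set" where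
  "frakC e = {C. C \<in> sets borel \<and>
     (\<forall>\<mu> \<nu>. radon \<mu> \<and> radon \<nu> \<and> concentrated_on \<nu> C \<and> preceq e \<mu> \<nu> \<longrightarrow> concentrated_on \<mu> C)}"

definition restrict_to :: "'c measure \<Rightarrow> 'c set \<Rightarrow> 'c measure" where
  "restrict_to m A = density m (indicator A)"

definition mutually_singular :: "'c measure \<Rightarrow> 'c measure \<Rightarrow> bool" where
  "mutually_singular m1 m2 \<longleftrightarrow>
     (\<exists>S \<in> sets m1. S \<in> sets m2 \<and> emeasure m1 S = 0 \<and> emeasure m2 (space m2 - S) = 0)"

end

theory Submission
  imports Defs
begin

text \<open>
  Let \<open>G0\<close> be the continuous extension of \<open>1 / (1 + d)\<close>. The functional
  \<open>q f = inf {\<integral>g d\<nu> | g \<in> G, g \<ge> f}\<close> is sublinear on the continuous functions, so by Hahn--Banach and Riesz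
  there is a Radon measure \<open>\<mu>\<close> below \<open>q\<close> with equality at \<open>- G0\<close>. Then \<open>\<mu> \<preceq> \<nu>\<close>, which gives (i), (ii)
  and the norm identity; equality at \<open>- G0\<close> provides for every \<open>\<epsilon> > 0\<close> some \<open>g \<in> G\<close> with \<open>G0 + g \<ge> 0\<close>
  and \<open>\<integral>G0 + g d\<mu> \<le> \<epsilon>\<close>.

  For (iii), \<open>d G0 = d / (1 + d)\<close> satisfies a strict triangle inequality. Hence \<open>h = G0 + g\<close> is bounded below at
  one of \<open>a\<close>, \<open>b\<close> whenever \<open>p2 a = p1 b\<close> and \<open>d(a)\<close>, \<open>d(b)\<close> are positive and finite. As \<open>\<integral>h d\<mu>\<close> is arbitrarily
  small, the \<open>p2\<close>-image of the set where \<open>h\<close> is small nearly carries the second marginal of \<open>\<mu>\<close> restricted to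
  \<open>0 < d < \<infinity>\<close> and nearly misses the first; Borel--Cantelli makes this exact. Test functions in \<open>G\<close> built from
  quotient pseudometrics show that \<open>\<mu>\<close>, like \<open>\<nu>\<close>, charges neither points at infinity nor \<open>\<Delta>(A)\<close>.
\<close>

section \<open>Hahn--Banach for sublinear functionals\<close>

definition sublinear :: "('v::real_vector \<Rightarrow> real) \<Rightarrow> bool" where
  "sublinear p \<longleftrightarrow> p 0 = 0 \<and> (\<forall>x y. p (x + y) \<le> p x + p y) \<and> (\<forall>c>0. \<forall>x. p (c *\<^sub>R x) = c * p x)"

text \<open>One direction of homogeneity is enough: \<open>scale\<close> at \<open>inverse c\<close>
  and \<open>c *\<^sub>R x\<close> yields the opposite inequality.\<close>

lemma sublinearI:
  assumes zero: "p 0 = 0" and add: "\<And>x y. p (x + y) \<le> p x + p y"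
    and scale: "\<And>c x. 0 < c \<Longrightarrow> p (c *\<^sub>R x) \<le> c * p x"
  shows "sublinear p"
proof -
  have "c * p x \<le> p (c *\<^sub>R x)" if "0 < c" for c x
    using scale[of "inverse c" "c *\<^sub>R x"] that by (simp add: field_simps)
  with scale have "p (c *\<^sub>R x) = c * p x" if "0 < c" for c x
    using that by (meson antisym)
  then show ?thesis
    using zero add by (simp add: sublinear_def)
qed

lemma sublinear_0: "sublinear p \<Longrightarrow> p 0 = 0"
  and sublinear_add: "sublinear p \<Longrightarrow> p (x + y) \<le> p x + p y"
  and sublinear_scale: "sublinear p \<Longrightarrow> 0 \<le> c \<Longrightarrow> p (c *\<^sub>R x) = c * p x"
  unfolding sublinear_def by (simp, simp, cases "c = 0", auto)

lemma sublinear_ge_neg: "sublinear p \<Longrightarrow> - p (- x) \<le> p x"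
  using sublinear_add[of p x "- x"] sublinear_0[of p] by simp

text \<open>\<open>q x\<close> is the infimum over t \<ge> 0 of
  \<open>p (x + t *\<^sub>R y) - t * p y\<close>; t = 0 gives q \<le> p and t = 1 gives the bound at
  - y. A minimal functional cannot be lowered in this way, so it must be odd, and an odd sublinear
  functional is linear.\<close>

lemma sublinear_shift:
  assumes p: "sublinear p"
  obtains q where "sublinear q" "q \<le> p" "q (- y) \<le> - p y"
proof -
  define a where "a x t = p (x + t *\<^sub>R y) - t * p y" for x t
  define q where "q x = (INF t\<in>{0..}. a x t)" for x
  have bdd: "bdd_below (a x ` {0..})" for x
  proof (rule bdd_belowI2)
    fix t :: real assume "t \<in> {0..}"
    then have "t * p y = p ((x + t *\<^sub>R y) + (- x))"
      using sublinear_scale[OF p] by simp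
    also have "\<dots> \<le> p (x + t *\<^sub>R y) + p (- x)"
      by (rule sublinear_add[OF p])
    finally show "- p (- x) \<le> a x t" by (simp add: a_def)
  qed
  have q_le: "q x \<le> a x t" if "0 \<le> t" for x t
    unfolding q_def using bdd that by (intro cINF_lower) auto
  have le_q: "c \<le> q x" if "\<And>t. 0 \<le> t \<Longrightarrow> c \<le> a x t" for c x
    unfolding q_def using that by (intro cINF_greatest) auto
  have "sublinear q"
  proof (rule sublinearI)
    have "a 0 t = 0" if "0 \<le> t" for t
      using that by (simp add: a_def sublinear_scale[OF p])
    then show "q 0 = 0"
      using q_le[of 0 0] le_q[of 0 0] by force
  next
    fix x x'
    have "q (x + x') - a x s \<le> a x' t" if "0 \<le> s" "0 \<le> t" for s t
    proof -
      have "q (x + x') \<le> a (x + x') (s + t)" using that by (intro q_le) auto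
      also have "\<dots> \<le> a x s + a x' t"
        using sublinear_add[OF p, of "x + s *\<^sub>R y" "x' + t *\<^sub>R y"]
        by (simp add: a_def algebra_simps)
      finally show ?thesis by simp
    qed
    then have "q (x + x') - q x' \<le> a x s" if "0 \<le> s" for s
      using le_q[of "q (x + x') - a x s" x'] that by fastforce
    then show "q (x + x') \<le> q x + q x'"
      using le_q[of "q (x + x') - q x'" x] by fastforce
  next
    fix c :: real and x assume c: "0 < c"
    have "q (c *\<^sub>R x) / c \<le> a x t" if "0 \<le> t" for t
    proof -
      have "q (c *\<^sub>R x) \<le> a (c *\<^sub>R x) (c * t)" using that c by (intro q_le) auto
      also have "\<dots> = c * a x t"
        using sublinear_scale[OF p, of c "x + t *\<^sub>R y"] c by (simp add: a_def algebra_simps)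
      finally show ?thesis using c by (simp add: field_simps)
    qed
    then have "q (c *\<^sub>R x) / c \<le> q x" by (rule le_q)
    then show "q (c *\<^sub>R x) \<le> c * q x" using c by (simp add: field_simps)
  qed
  moreover have "q \<le> p"
    using q_le[of 0] by (simp add: le_fun_def a_def)
  moreover have "q (- y) \<le> - p y"
    using q_le[of 1 "- y"] sublinear_0[OF p] by (simp add: a_def)
  ultimately show thesis using that by blast
qed

text \<open>Subadditivity is the only point where the chain matters: for two members p and q the
  smaller one, evaluated at x + y, is below \<open>p x + q y\<close>.\<close>

lemma sublinear_Inf_chain:
  assumes "C \<noteq> {}" and sub: "\<And>p. p \<in> C \<Longrightarrow> sublinear p"
    and chain: "\<And>p q. p \<in> C \<Longrightarrow> q \<in> C \<Longrightarrow> p \<le> q \<or> q \<le> p"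
    and bdd: "\<And>x. bdd_below ((\<lambda>p. p x) ` C)"
  shows "sublinear (\<lambda>x. INF p\<in>C. p x)"
proof (rule sublinearI)
  show "(INF p\<in>C. p 0) = 0"
    using \<open>C \<noteq> {}\<close> sub by (simp add: sublinear_0)
next
  fix x y
  have *: "(INF p\<in>C. p (x + y)) \<le> p x + q y" if pq: "p \<in> C" "q \<in> C" for p q
  proof -
    obtain r where r: "r \<in> C" "r \<le> p" "r \<le> q"
      using chain[OF pq] pq by blast
    have "(INF p\<in>C. p (x + y)) \<le> r (x + y)"
      by (rule cINF_lower[OF bdd r(1)])
    also have "\<dots> \<le> r x + r y" using sub[OF r(1)] by (rule sublinear_add)
    also have "\<dots> \<le> p x + q y" using r by (intro add_mono) (auto simp: le_fun_def)
    finally show ?thesis .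
  qed
  have "(INF p\<in>C. p (x + y)) - (INF p\<in>C. p y) \<le> p x" if "p \<in> C" for p
  proof -
    have "(INF p\<in>C. p (x + y)) - p x \<le> (INF p\<in>C. p y)"
      using *[OF that] by (intro cINF_greatest[OF \<open>C \<noteq> {}\<close>]) (simp add: algebra_simps)
    then show ?thesis by simp
  qed
  then have "(INF p\<in>C. p (x + y)) - (INF p\<in>C. p y) \<le> (INF p\<in>C. p x)"
    by (intro cINF_greatest[OF \<open>C \<noteq> {}\<close>])
  then show "(INF p\<in>C. p (x + y)) \<le> (INF p\<in>C. p x) + (INF p\<in>C. p y)" by simp
next
  fix c :: real and x assume c: "0 < c"
  have "(INF p\<in>C. p (c *\<^sub>R x)) / c \<le> p x" if "p \<in> C" for p
    using cINF_lower[OF bdd that, of "c *\<^sub>R x"] sublinear_scale[OF sub[OF that], of c x] c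
    by (simp add: field_simps)
  then have "(INF p\<in>C. p (c *\<^sub>R x)) / c \<le> (INF p\<in>C. p x)"
    by (intro cINF_greatest[OF \<open>C \<noteq> {}\<close>])
  then show "(INF p\<in>C. p (c *\<^sub>R x)) \<le> c * (INF p\<in>C. p x)"
    using c by (simp add: field_simps)
qed

text \<open>Zorn's lemma for the reversed order, so that the required upper bound of a chain is its
  pointwise infimum. This infimum is finite because every sublinear q \<le> p satisfies
  \<open>- p (- x) \<le> q x\<close>.\<close>

lemma minimal_sublinear_below:
  fixes p :: "'v::real_vector \<Rightarrow> real"
  assumes p: "sublinear p"
  obtains m where "sublinear m" "m \<le> p" "\<And>q. sublinear q \<Longrightarrow> q \<le> m \<Longrightarrow> q = m"
proof -
  define S where "S = {q. sublinear q \<and> q \<le> p}"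
  have "\<exists>m\<in>S. \<forall>q\<in>S. m \<ge> q \<longrightarrow> q = m"
  proof (rule predicate_Zorn)
    show "partial_order_on S (relation_of (\<ge>) S)"
      by (rule partial_order_on_relation_ofI) auto
    fix C assume C: "C \<in> Chains (relation_of (\<ge>) S)"
    then have CS: "C \<subseteq> S" and chain: "q \<le> r \<or> r \<le> q" if "q \<in> C" "r \<in> C" for q r
      using that by (auto simp: Chains_def relation_of_def)
    show "\<exists>u\<in>S. \<forall>q\<in>C. q \<ge> u"
    proof (cases "C = {}")
      case True
      then show ?thesis using p by (auto simp: S_def)
    next
      case False
      have CS: "C \<subseteq> S" using C by (auto simp: Chains_def relation_of_def)
      have lb: "- p (- x) \<le> q x" if "q \<in> C" for q x
      proof -
        have "sublinear q" "q (- x) \<le> p (- x)" using that CS by (auto simp: S_def le_fun_def)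
        then show ?thesis using sublinear_ge_neg[of q x] by simp
      qed
      then have bdd: "bdd_below ((\<lambda>q. q x) ` C)" for x
        by (intro bdd_belowI2)
      let ?u = "\<lambda>x. INF q\<in>C. q x"
      have u: "?u \<le> q" if "q \<in> C" for q
        using cINF_lower[OF bdd that] by (simp add: le_fun_def)
      moreover obtain q where "q \<in> C" using False by blast
      moreover have "sublinear ?u"
        using CS by (intro sublinear_Inf_chain False chain bdd) (auto simp: S_def)
      ultimately show ?thesis
        using CS by (intro bexI[of _ ?u]) (auto simp: S_def intro: order_trans)
    qed
  qed
  then obtain m where "m \<in> S" and min: "\<And>q. q \<in> S \<Longrightarrow> q \<le> m \<Longrightarrow> q = m" by blast
  then show thesis
    using that[of m] by (auto simp: S_def intro: order_trans)
qed

text \<open>Shifting p at x0 before minimising secures equality there: any odd functional below the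
  shifted one takes at x0 a value of at least \<open>p x0\<close>. Minimality then forces oddness at
  every other vector, hence linearity.\<close>

theorem hahn_banach_sublinear:
  fixes p :: "'v::real_vector \<Rightarrow> real"
  assumes p: "sublinear p"
  obtains m where "linear m" "m \<le> p" "m x0 = p x0"
proof -
  obtain q where q: "sublinear q" "q \<le> p" "q (- x0) \<le> - p x0"
    using sublinear_shift[OF p] .
  obtain m where m: "sublinear m" "m \<le> q" and min: "\<And>r. sublinear r \<Longrightarrow> r \<le> m \<Longrightarrow> r = m"
    using minimal_sublinear_below[OF q(1)] by blast
  have neg: "m (- y) = - m y" for y
  proof -
    obtain r where "sublinear r" "r \<le> m" "r (- y) \<le> - m y"
      using sublinear_shift[OF m(1)] .
    with min[of r] have "m (- y) \<le> - m y" by simp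
    then show ?thesis using sublinear_ge_neg[OF m(1), of "- y"] by simp
  qed
  have "linear m"
  proof (rule linearI)
    fix x y
    have "m x \<le> m (x + y) + m (- y)"
      using sublinear_add[OF m(1), of "x + y" "- y"] by simp
    then show "m (x + y) = m x + m y"
      using sublinear_add[OF m(1), of x y] neg by (simp add: antisym)
  next
    fix c x
    show "m (c *\<^sub>R x) = c *\<^sub>R m x"
    proof (cases "0 \<le> c")
      case True
      then show ?thesis using sublinear_scale[OF m(1)] by simp
    next
      case False
      then have "m ((- c) *\<^sub>R x) = - c * m x" using sublinear_scale[OF m(1), of "- c"] by simp
      then show ?thesis using neg[of "c *\<^sub>R x"] by simp
    qed
  qed
  moreover have "m \<le> p" using m q by (auto intro: order_trans)
  moreover have "m x0 = p x0"
  proof (rule antisym)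
    show "m x0 \<le> p x0" using \<open>m \<le> p\<close> by (simp add: le_fun_def)
    have "- m x0 \<le> - p x0" using neg[of x0] m(2) q(3) by (metis le_funD order_trans)
    then show "p x0 \<le> m x0" by simp
  qed
  ultimately show thesis using that by blast
qed

section \<open>The Riesz representation theorem on compact Hausdorff spaces\<close>

lemma Urysohn_compact_space:
  fixes S T :: "'b::t2_space set"
  assumes "compact (UNIV :: 'b set)" "closed S" "closed T" "S \<inter> T = {}"
  shows "\<exists>f :: 'b \<Rightarrow> real. continuous_on UNIV f \<and> (\<forall>x. 0 \<le> f x \<and> f x \<le> 1) \<and> (\<forall>x\<in>S. f x = 0) \<and> (\<forall>x\<in>T. f x = 1)"
proof -
  have "Hausdorff_space (euclidean :: 'b topology)"
    using hausdorff by (fastforce simp: Hausdorff_space_def disjnt_def)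
  moreover have "compact_space (euclidean :: 'b topology)"
    using assms(1) by (simp add: compact_space_def)
  ultimately have "normal_space (euclidean :: 'b topology)"
    by (simp add: compact_Hausdorff_or_regular_imp_normal_space)
  then obtain f where f: "continuous_map euclidean (top_of_set {0..1}) f" "f ` S \<subseteq> {0}" "f ` T \<subseteq> {1::real}"
    using Urysohn_lemma[of "euclidean :: 'b topology" S T 0 1] assms by (auto simp: disjnt_def)
  have "continuous_on UNIV f" "\<And>x. f x \<in> {0..1}"
    using f(1) by (auto simp: continuous_map_in_subtopology)
  then show ?thesis
    using f(2,3) by (intro exI[of _ f]) (auto simp: image_subset_iff)
qed

locale positive_functional =
  fixes L :: "('b::t2_space \<Rightarrow> real) \<Rightarrow> real"
  assumes compact_UNIV: "compact (UNIV :: 'b set)"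
    and add: "continuous_on UNIV f \<Longrightarrow> continuous_on UNIV g \<Longrightarrow> L (\<lambda>x. f x + g x) = L f + L g"
    and scale: "continuous_on UNIV f \<Longrightarrow> L (\<lambda>x. c * f x) = c * L f"
    and nonneg: "continuous_on UNIV f \<Longrightarrow> (\<And>x. 0 \<le> f x) \<Longrightarrow> 0 \<le> L f"
begin

lemma mono: "L f \<le> L g"
  if "continuous_on UNIV f" "continuous_on UNIV g" "\<And>x. f x \<le> g x"
proof -
  have d: "continuous_on UNIV (\<lambda>x. g x - f x)" using that by (intro continuous_intros)
  have "L (\<lambda>x. f x + (g x - f x)) = L f + L (\<lambda>x. g x - f x)" by (intro add d that)
  moreover have "0 \<le> L (\<lambda>x. g x - f x)" using that d by (intro nonneg) auto
  ultimately show ?thesis by simp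
qed

lemma const: "L (\<lambda>_. c) = c * L (\<lambda>_. 1)"
  using scale[of "\<lambda>_. 1" c] by simp

lemma sum: "L (\<lambda>x. \<Sum>i\<in>I. f i x) = (\<Sum>i\<in>I. L (f i))"
  if "\<And>i. i \<in> I \<Longrightarrow> continuous_on UNIV (f i)"
  using that
proof (induction I rule: infinite_finite_induct)
  case (insert j I)
  then show ?case by (simp add: add continuous_on_sum)
qed (use const[of 0] in auto)

lemma add_const: "L (\<lambda>x. f x + c) = L f + c * L (\<lambda>_. 1)" if "continuous_on UNIV f"
  using add[OF that continuous_on_const[of UNIV c]] const[of c] by simp

section \<open>The content of open sets\<close>

definition below :: "'b set \<Rightarrow> ('b \<Rightarrow> real) set" where
  "below U = {f. continuous_on UNIV f \<and> (\<forall>x. 0 \<le> f x \<and> f x \<le> indicator U x)}"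

definition open_content :: "'b set \<Rightarrow> ennreal" where
  "open_content U = (SUP f\<in>below U. ennreal (L f))"

lemma belowI:
  "continuous_on UNIV f \<Longrightarrow> (\<And>x. 0 \<le> f x) \<Longrightarrow> (\<And>x. f x \<le> 1) \<Longrightarrow> (\<And>x. x \<notin> U \<Longrightarrow> f x \<le> 0) \<Longrightarrow> f \<in> below U"
  by (auto simp: below_def indicator_def)

lemma belowD:
  assumes "f \<in> below U"
  shows "continuous_on UNIV f" "0 \<le> f x" "f x \<le> 1" "x \<notin> U \<Longrightarrow> f x = 0"
proof -
  have *: "continuous_on UNIV f" "0 \<le> f x" "f x \<le> indicator U x"
    using assms by (auto simp: below_def)
  then show "continuous_on UNIV f" "0 \<le> f x" by auto
  show "f x \<le> 1" using *(3) by (rule order_trans) (rule indicator_le_1)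
  show "x \<notin> U \<Longrightarrow> f x = 0" using * by simp
qed

lemma zero_below: "(\<lambda>_. 0) \<in> below U"
  by (auto intro: belowI)

lemma L_le_open_content: "f \<in> below U \<Longrightarrow> ennreal (L f) \<le> open_content U"
  unfolding open_content_def by (rule SUP_upper)

lemma open_content_mono: "U \<subseteq> V \<Longrightarrow> open_content U \<le> open_content V"
  unfolding open_content_def
  by (rule SUP_subset_mono) (auto intro!: belowI dest: belowD simp: belowD(4))

lemma open_content_empty: "open_content {} = 0"
proof -
  have "ennreal (L f) \<le> 0" if f: "f \<in> below {}" for f
  proof -
    have "f = (\<lambda>_. 0)" using belowD(4)[OF f] by auto
    then show ?thesis using const[of 0] by simp
  qed
  then have "open_content {} \<le> 0"
    unfolding open_content_def by (rule SUP_least)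
  then show ?thesis by simp
qed

lemma open_content_UNIV: "open_content UNIV = ennreal (L (\<lambda>_. 1))"
proof (rule antisym)
  show "open_content UNIV \<le> ennreal (L (\<lambda>_. 1))"
    unfolding open_content_def
    by (intro SUP_least ennreal_leI mono) (auto dest: belowD)
  show "ennreal (L (\<lambda>_. 1)) \<le> open_content UNIV"
    by (intro L_le_open_content belowI) auto
qed

text \<open>Members of \<open>below U\<close> are dominated by the indicator but need not have
  support inside U. Cutting off height e costs at most e times the total mass and leaves a function
  positive only on {e < f}; for e > 0 this lies in the compact set {e \<le> f}, contained in
  U.\<close>

lemma truncate:
  assumes f: "f \<in> below U" and e: "0 \<le> e"
  shows "(\<lambda>x. max (f x - e) 0) \<in> below U" "L f \<le> L (\<lambda>x. max (f x - e) 0) + e * L (\<lambda>_. 1)"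
proof -
  note [continuous_intros] = belowD(1)[OF f]
  show "(\<lambda>x. max (f x - e) 0) \<in> below U"
  proof (intro belowI continuous_intros)
    fix x show "max (f x - e) 0 \<le> 1" using e belowD(3)[OF f, of x] by simp
    show "x \<notin> U \<Longrightarrow> max (f x - e) 0 \<le> 0" using e belowD(4)[OF f, of x] by simp
  qed auto
  have "L f \<le> L (\<lambda>x. max (f x - e) 0 + e)"
    by (intro mono continuous_intros) auto
  also have "\<dots> = L (\<lambda>x. max (f x - e) 0) + e * L (\<lambda>_. 1)"
    by (intro add_const continuous_intros)
  finally show "L f \<le> L (\<lambda>x. max (f x - e) 0) + e * L (\<lambda>_. 1)" .
qed

lemma scaled_epsilon:
  assumes "0 < (d::real)"
  obtains e where "0 < e" "e * L (\<lambda>_. 1) \<le> d"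
proof
  have *: "0 \<le> L (\<lambda>_. 1)" by (rule nonneg) auto
  \<comment> \<open>The summand 1 keeps the denominator positive when
    \<open>L (\<lambda>_. 1)\<close> is 0.\<close>
  then show "0 < d / (L (\<lambda>_. 1) + 1)" "d / (L (\<lambda>_. 1) + 1) * L (\<lambda>_. 1) \<le> d"
    using assms by (auto simp: field_simps)
qed

text \<open>A Urysohn function c that is 0 off U and 1 on {e \<le> f} - V splits f: the product f c
  lives on U, and f - f c exceeds e only inside V, so cutting it at e puts it below V.\<close>

lemma open_content_Un:
  assumes U: "open U" and V: "open V"
  shows "open_content (U \<union> V) \<le> open_content U + open_content V"
  unfolding open_content_def[of "U \<union> V"]
proof (rule SUP_least, rule ennreal_le_epsilon)
  fix f and d :: real assume f: "f \<in> below (U \<union> V)" and d: "0 < d"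
  obtain e where e: "0 < e" "e * L (\<lambda>_. 1) \<le> d" using scaled_epsilon[OF d] .
  note [continuous_intros] = belowD(1)[OF f]
  have "closed {x. e \<le> f x}" by (intro closed_Collect_le continuous_intros)
  then have cl: "closed (- U)" "closed ({x. e \<le> f x} - V)" using U V by auto
  have "x \<in> U \<union> V" if "e \<le> f x" for x
    using belowD(4)[OF f, of x] e(1) that by force
  then have disj: "- U \<inter> ({x. e \<le> f x} - V) = {}" by blast
  obtain c :: "'b \<Rightarrow> real" where c: "continuous_on UNIV c \<and> (\<forall>x. 0 \<le> c x \<and> c x \<le> 1) \<and>
      (\<forall>x\<in>- U. c x = 0) \<and> (\<forall>x\<in>{x. e \<le> f x} - V. c x = 1)"
    using Urysohn_compact_space[OF compact_UNIV cl disj] ..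
  then have [continuous_intros]: "continuous_on UNIV c" and c01: "\<And>x. 0 \<le> c x" "\<And>x. c x \<le> 1"
    and c0: "\<And>x. x \<in> - U \<Longrightarrow> c x = 0" and c1: "\<And>x. x \<in> {x. e \<le> f x} - V \<Longrightarrow> c x = 1"
    by (auto simp del: Diff_iff mem_Collect_eq Compl_iff)
  let ?f1 = "\<lambda>x. f x * c x" and ?f2 = "\<lambda>x. max (f x - f x * c x - e) 0"
  note f0 = belowD(2)[OF f] and f1 = belowD(3)[OF f]
  have 1: "?f1 \<in> below U"
    using c01 c0 f0 f1 by (intro belowI continuous_intros) (auto intro: mult_le_one)
  have "f x - f x * c x - e \<le> 0" if "x \<notin> V" for x
  proof (cases "e \<le> f x")
    case True
    then have "c x = 1" using that by (intro c1) simp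
    then show ?thesis using e(1) by simp
  next
    case False
    then show ?thesis using mult_nonneg_nonneg[OF f0[of x] c01(1)[of x]] by linarith
  qed
  moreover have "f x - f x * c x - e \<le> 1" for x
    using f1[of x] e(1) mult_nonneg_nonneg[OF f0[of x] c01(1)[of x]] by linarith
  ultimately have 2: "?f2 \<in> below V"
    by (intro belowI continuous_intros) auto
  note cont1 = belowD(1)[OF 1] and cont2 = belowD(1)[OF 2]
  have "L f \<le> L (\<lambda>x. (?f1 x + ?f2 x) + e)"
    by (intro mono belowD(1)[OF f] continuous_on_add cont1 cont2 continuous_on_const) simp
  also have "\<dots> = L ?f1 + L ?f2 + e * L (\<lambda>_. 1)"
    by (simp only: add_const[OF continuous_on_add[OF cont1 cont2]] add[OF cont1 cont2])
  finally have "L f \<le> L ?f1 + L ?f2 + d" using e by simp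
  moreover have "0 \<le> L ?f1" "0 \<le> L ?f2"
    by (rule nonneg[OF belowD(1,2)[OF 1]], rule nonneg[OF belowD(1,2)[OF 2]])
  ultimately have "ennreal (L f) \<le> ennreal (L ?f1) + ennreal (L ?f2) + ennreal d"
    using d by (simp add: ennreal_leI flip: ennreal_plus)
  also have "\<dots> \<le> open_content U + open_content V + ennreal d"
    by (intro add_mono L_le_open_content 1 2 order_refl)
  finally show "ennreal (L f) \<le> open_content U + open_content V + ennreal d" .
qed

lemma open_content_finite_UN:
  "finite I \<Longrightarrow> (\<And>i. i \<in> I \<Longrightarrow> open (U i)) \<Longrightarrow> open_content (\<Union>i\<in>I. U i) \<le> (\<Sum>i\<in>I. open_content (U i))"
proof (induction I rule: finite_induct)
  case (insert j I)
  have "open_content (\<Union>i\<in>insert j I. U i) \<le> open_content (U j) + open_content (\<Union>i\<in>I. U i)"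
    using insert by (auto intro!: open_content_Un open_UN)
  also have "\<dots> \<le> open_content (U j) + (\<Sum>i\<in>I. open_content (U i))"
    using insert by (intro add_left_mono) auto
  finally show ?case using insert by simp
qed (simp add: open_content_empty)

text \<open>The set {e \<le> f} is compact and covered by the \<open>U i\<close>, so the truncated f
  already lives on a finite union.\<close>

lemma open_content_UN:
  assumes U: "\<And>i::nat. open (U i)"
  shows "open_content (\<Union>i. U i) \<le> (\<Sum>i. open_content (U i))"
  unfolding open_content_def[of "\<Union>i. U i"]
proof (rule SUP_least, rule ennreal_le_epsilon)
  fix f and d :: real assume f: "f \<in> below (\<Union>i. U i)" and d: "0 < d"
  obtain e where e: "0 < e" "e * L (\<lambda>_. 1) \<le> d" using scaled_epsilon[OF d] .
  note [continuous_intros] = belowD(1)[OF f]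
  have "closed {x. e \<le> f x}" by (intro closed_Collect_le continuous_intros)
  then have K: "compact {x. e \<le> f x}" using compact_Int_closed[OF compact_UNIV] by simp
  have "{x. e \<le> f x} \<subseteq> (\<Union>i\<in>UNIV. U i)"
  proof
    fix x assume "x \<in> {x. e \<le> f x}"
    then have "f x \<noteq> 0" using e(1) by auto
    then show "x \<in> (\<Union>i. U i)" using belowD(4)[OF f, of x] by meson
  qed
  then obtain I where I: "finite I" "{x. e \<le> f x} \<subseteq> (\<Union>i\<in>I. U i)"
    by (rule compactE_image[OF K U])
  let ?g = "\<lambda>x. max (f x - e) 0"
  have g: "?g \<in> below (\<Union>i\<in>I. U i)"
  proof (rule belowI)
    note * = belowD[OF truncate(1)[OF f less_imp_le[OF e(1)]]]
    show "continuous_on UNIV ?g" by (rule *(1))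
    fix x
    show "0 \<le> ?g x" "?g x \<le> 1" by (rule *)+
    show "?g x \<le> 0" if "x \<notin> (\<Union>i\<in>I. U i)"
    proof -
      have "x \<notin> {x. e \<le> f x}" using that I(2) by blast
      then show ?thesis by simp
    qed
  qed
  have "ennreal (L f) \<le> ennreal (L ?g + d)"
    using truncate(2)[OF f, of e] e by (intro ennreal_leI) linarith
  also have "\<dots> = ennreal (L ?g) + ennreal d"
    using d by (intro ennreal_plus nonneg[OF belowD(1,2)[OF g]]) auto
  also have "\<dots> \<le> open_content (\<Union>i\<in>I. U i) + ennreal d"
    by (intro add_right_mono L_le_open_content g)
  also have "\<dots> \<le> (\<Sum>i\<in>I. open_content (U i)) + ennreal d"
    using U I(1) by (intro add_right_mono open_content_finite_UN)
  also have "\<dots> \<le> (\<Sum>i. open_content (U i)) + ennreal d"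
    using I(1) by (intro add_right_mono sum_le_suminf) auto
  finally show "ennreal (L f) \<le> (\<Sum>i. open_content (U i)) + ennreal d" .
qed

section \<open>The induced outer measure and measurability of open sets\<close>

definition outer :: "'b set \<Rightarrow> ennreal" where
  "outer A = (INF U\<in>{U. open U \<and> A \<subseteq> U}. open_content U)"

lemma outer_le: "open U \<Longrightarrow> A \<subseteq> U \<Longrightarrow> outer A \<le> open_content U"
  unfolding outer_def by (rule INF_lower) simp

lemma outer_open: "open U \<Longrightarrow> outer U = open_content U"
  by (intro antisym outer_le) (auto simp: outer_def intro!: INF_greatest open_content_mono)

lemma outer_mono: "A \<subseteq> B \<Longrightarrow> outer A \<le> outer B"
  unfolding outer_def by (rule INF_superset_mono) auto

lemma outer_finite: "outer A < top"
proof -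
  have "outer A \<le> ennreal (L (\<lambda>_. 1))"
    using outer_le[of UNIV A] by (simp add: open_content_UNIV)
  then show ?thesis using ennreal_less_top by (rule le_less_trans)
qed

lemma outer_approx:
  assumes "0 < (d::real)"
  obtains U where "open U" "A \<subseteq> U" "open_content U \<le> outer A + ennreal d"
proof -
  have "outer A < outer A + ennreal d"
    using outer_finite[of A] assms ennreal_add_left_cancel_less[of "outer A" 0 "ennreal d"] by simp
  then have "(INF U\<in>{U. open U \<and> A \<subseteq> U}. open_content U) < outer A + ennreal d"
    by (simp add: outer_def)
  then show thesis using that by (auto simp: INF_less_iff)
qed

lemma outer_UN: "outer (\<Union>i::nat. A i) \<le> (\<Sum>i. outer (A i))"
proof (rule ennreal_le_epsilon)
  fix d :: real assume d: "0 < d"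
  have "\<forall>i. \<exists>U. open U \<and> A i \<subseteq> U \<and> open_content U \<le> outer (A i) + ennreal (d * (1/2) ^ Suc i)"
  proof
    fix i
    have "0 < d * (1/2) ^ Suc i" using d by simp
    from outer_approx[OF this, of "A i"]
    show "\<exists>U. open U \<and> A i \<subseteq> U \<and> open_content U \<le> outer (A i) + ennreal (d * (1/2) ^ Suc i)" by metis
  qed
  then obtain U where U: "\<And>i. open (U i)" "\<And>i. A i \<subseteq> U i"
    "\<And>i. open_content (U i) \<le> outer (A i) + ennreal (d * (1/2) ^ Suc i)"
    using choice[of "\<lambda>i U. open U \<and> A i \<subseteq> U \<and> open_content U \<le> outer (A i) + ennreal (d * (1/2) ^ Suc i)"]
    by blast
  have "outer (\<Union>i. A i) \<le> open_content (\<Union>i. U i)"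
    using U by (intro outer_le) auto
  also have "\<dots> \<le> (\<Sum>i. open_content (U i))" using U by (intro open_content_UN)
  also have "\<dots> \<le> (\<Sum>i. outer (A i) + ennreal (d * (1/2) ^ Suc i))"
    by (intro suminf_le U summableI)
  also have "\<dots> = (\<Sum>i. outer (A i)) + (\<Sum>i. ennreal (d * (1/2) ^ Suc i))"
    by (intro suminf_add[symmetric] summableI)
  also have "(\<Sum>i. ennreal (d * (1/2) ^ Suc i)) = ennreal (d * 1)"
    using d by (intro suminf_ennreal_eq sums_mult power_half_series) auto
  finally show "outer (\<Union>i. A i) \<le> (\<Sum>i. outer (A i)) + ennreal d" by simp
qed

lemma outer_measure_space_outer: "outer_measure_space UNIV outer"
  unfolding outer_measure_space_def positive_def increasing_def countably_subadditive_def
  using outer_open[of "{}"] open_content_empty by (auto intro: outer_mono outer_UN)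

text \<open>For f below W \<inter> U, truncation at e leaves a function vanishing off K = {e \<le>
  f}, while any g below W - K vanishes on K. Their sum is therefore at most 1 and lies below W, so
  the two contents add up inside W; suprema over g and f finish.\<close>

lemma outer_Int_Diff_open:
  assumes U: "open U" and W: "open W"
  shows "outer (W \<inter> U) + outer (W - U) \<le> open_content W"
proof -
  have "ennreal (L f) + outer (W - U) \<le> open_content W" if f: "f \<in> below (W \<inter> U)" for f
  proof (rule ennreal_le_epsilon)
    fix d :: real assume d: "0 < d"
    obtain e where e: "0 < e" "e * L (\<lambda>_. 1) \<le> d" using scaled_epsilon[OF d] .
    note [continuous_intros] = belowD(1)[OF f]
    define K where "K = {x. e \<le> f x}"
    have "closed K" unfolding K_def by (intro closed_Collect_le continuous_intros)
    then have oWK: "open (W - K)" using W by blast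
    have KU: "K \<subseteq> W \<inter> U"
    proof
      fix x assume "x \<in> K"
      then have "f x \<noteq> 0" using e(1) by (auto simp: K_def)
      then show "x \<in> W \<inter> U" using belowD(4)[OF f, of x] by blast
    qed
    let ?f = "\<lambda>x. max (f x - e) 0"
    have fb: "?f \<in> below (W \<inter> U)" using truncate(1)[OF f] e by auto
    have f0: "0 \<le> L ?f" by (rule nonneg[OF belowD(1,2)[OF fb]])
    have "ennreal (L f) + ennreal (L g) \<le> open_content W + ennreal d" if g: "g \<in> below (W - K)" for g
    proof -
      note [continuous_intros] = belowD(1)[OF g]
      have g0: "0 \<le> L g" by (rule nonneg[OF belowD(1,2)[OF g]])
      have fg: "(\<lambda>x. ?f x + g x) \<in> below W"
      proof (rule belowI)
        fix x
        show "?f x + g x \<le> 1"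
          using belowD(2,3)[OF fb, of x] belowD(2-4)[OF g, of x] by (cases "x \<in> K") (auto simp: K_def max_def)
        show "?f x + g x \<le> 0" if "x \<notin> W"
          using belowD(4)[OF fb, of x] belowD(4)[OF g, of x] that by auto
        show "0 \<le> ?f x + g x" using belowD(2)[OF fb, of x] belowD(2)[OF g, of x] by auto
      qed (intro continuous_intros)
      have "L f + L g \<le> L (\<lambda>x. ?f x + g x) + d"
        using truncate(2)[OF f, of e] e add[OF belowD(1)[OF fb] belowD(1)[OF g]] by simp
      moreover have "0 \<le> L f" "0 \<le> L (\<lambda>x. ?f x + g x)"
        by (rule nonneg[OF belowD(1,2)[OF f]], rule nonneg[OF belowD(1,2)[OF fg]])
      ultimately have "ennreal (L f) + ennreal (L g) \<le> ennreal (L (\<lambda>x. ?f x + g x)) + ennreal d"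
        using g0 d by (simp add: ennreal_leI flip: ennreal_plus)
      also have "\<dots> \<le> open_content W + ennreal d"
        by (intro add_right_mono L_le_open_content fg)
      finally show ?thesis .
    qed
    then have "(SUP g\<in>below (W - K). ennreal (L g) + ennreal (L f)) \<le> open_content W + ennreal d"
      by (intro SUP_least) (simp add: add.commute)
    then have "open_content (W - K) + ennreal (L f) \<le> open_content W + ennreal d"
      unfolding open_content_def[of "W - K"]
      by (subst (asm) ennreal_SUP_add_left) (use zero_below in auto)
    moreover have "outer (W - U) \<le> open_content (W - K)"
      using oWK KU by (intro outer_le) auto
    ultimately show "ennreal (L f) + outer (W - U) \<le> open_content W + ennreal d"
      by (metis add.commute add_right_mono order_trans)
  qed
  then have "(SUP f\<in>below (W \<inter> U). ennreal (L f) + outer (W - U)) \<le> open_content W"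
    by (intro SUP_least)
  then have "open_content (W \<inter> U) + outer (W - U) \<le> open_content W"
    unfolding open_content_def[of "W \<inter> U"]
    by (subst (asm) ennreal_SUP_add_left) (use zero_below in auto)
  then show ?thesis
    using outer_open[OF open_Int[OF W U]] by simp
qed

text \<open>An arbitrary test set A is replaced by open W containing A, which reduces the
  Caratheodory condition to open test sets.\<close>

lemma open_in_lambda_system: "open U \<Longrightarrow> U \<in> lambda_system UNIV UNIV outer"
proof -
  assume U: "open U"
  interpret sigma_algebra UNIV "UNIV :: 'b set set" using sigma_algebra_Pow[of UNIV] by simp
  have "outer (A \<inter> U) + outer (A - U) \<le> outer A" for A
    unfolding outer_def[of A]
  proof (rule INF_greatest)
    fix W assume W: "W \<in> {W. open W \<and> A \<subseteq> W}"
    have "outer (A \<inter> U) + outer (A - U) \<le> outer (W \<inter> U) + outer (W - U)"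
      using W by (intro add_mono outer_mono) auto
    also have "\<dots> \<le> open_content W" using U W by (intro outer_Int_Diff_open) auto
    finally show "outer (A \<inter> U) + outer (A - U) \<le> open_content W" .
  qed
  moreover have "outer A \<le> outer (A \<inter> U) + outer (A - U)" for A
  proof -
    have "subadditive UNIV outer"
      using outer_measure_space_outer countably_subadditive_subadditive[of outer]
      unfolding outer_measure_space_def by blast
    then have "X \<inter> Y = {} \<Longrightarrow> outer (X \<union> Y) \<le> outer X + outer Y" for X Y
      by (simp add: subadditive_def)
    from this[OF Int_Diff_disjoint] have "outer ((A \<inter> U) \<union> (A - U)) \<le> outer (A \<inter> U) + outer (A - U)" .
    then show ?thesis by (simp add: Int_Diff_Un)
  qed
  ultimately have "outer (A \<inter> U) + outer (A - U) = outer A" for A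
    by (rule antisym)
  then show ?thesis
    by (simp add: lambda_system_eq)
qed

section \<open>The representing measure and its regularity\<close>

definition repr_measure :: "'b measure" where
  "repr_measure = measure_of UNIV (sets borel) outer"

lemma sets_repr [simp, measurable_cong]: "sets repr_measure = sets borel"
  and space_repr [simp]: "space repr_measure = UNIV"
  unfolding repr_measure_def using sets.sigma_sets_eq[of borel] by auto

lemma emeasure_repr: "A \<in> sets borel \<Longrightarrow> emeasure repr_measure A = outer A"
proof -
  interpret sigma_algebra UNIV "UNIV :: 'b set set" using sigma_algebra_Pow[of UNIV] by simp
  have ms: "measure_space UNIV (lambda_system UNIV UNIV outer) outer"
    using caratheodory_lemma[OF outer_measure_space_outer] .
  then have "sigma_sets UNIV {U. open U} \<subseteq> lambda_system UNIV UNIV outer"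
    using sigma_algebra.sigma_sets_subset[of UNIV "lambda_system UNIV UNIV outer" "{U. open U}"]
      open_in_lambda_system by (auto simp: measure_space_def)
  then have sub: "sets borel \<subseteq> lambda_system UNIV UNIV outer" by (simp add: borel_def)
  have "sigma_algebra UNIV (sets (borel :: 'b measure))"
    using sets.sigma_algebra_axioms[of "borel :: 'b measure"] by simp
  then have "measure_space UNIV (sets borel) outer"
    using measure_down[OF ms] sub by blast
  then show "A \<in> sets borel \<Longrightarrow> emeasure repr_measure A = outer A"
    unfolding repr_measure_def by (intro emeasure_measure_of_sigma) (auto simp: measure_space_def)
qed

lemma finite_measure_repr: "finite_measure repr_measure"
  using outer_finite[of UNIV] by (intro finite_measureI) (simp add: emeasure_repr)

lemma measure_repr_UNIV: "measure repr_measure UNIV = L (\<lambda>_. 1)"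
  using nonneg[of "\<lambda>_. 1"]
  by (simp add: measure_def emeasure_repr outer_open open_content_UNIV)

text \<open>Inner regularity of A is outer regularity of the complement: if U is open, contains - A
  and has nearly the same measure, then - U is a compact subset of A that misses little of
  it.\<close>

lemma radon_repr: "radon repr_measure"
  unfolding radon_def
proof (intro conjI ballI)
  interpret finite_measure repr_measure by (rule finite_measure_repr)
  show "sets repr_measure = sets borel" by simp
  show "emeasure repr_measure (space repr_measure) < \<infinity>" by (simp add: less_top[symmetric])
  fix A :: "'b set" assume A: "A \<in> sets borel"
  show "emeasure repr_measure A = (SUP K\<in>{K. compact K \<and> K \<subseteq> A}. emeasure repr_measure K)"
  proof (rule antisym)
    show "(SUP K\<in>{K. compact K \<and> K \<subseteq> A}. emeasure repr_measure K) \<le> emeasure repr_measure A"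
      using A by (intro SUP_least emeasure_mono) auto
    show "emeasure repr_measure A \<le> (SUP K\<in>{K. compact K \<and> K \<subseteq> A}. emeasure repr_measure K)"
    proof (rule ennreal_le_epsilon)
      fix d :: real assume d: "0 < d"
      obtain U where U: "open U" "- A \<subseteq> U" "open_content U \<le> outer (- A) + ennreal d"
        using outer_approx[OF d] .
      have K: "compact (- U)" "- U \<subseteq> A"
        using U compact_UNIV compact_Int_closed[of UNIV "- U"] by auto
      have Ab: "- A \<in> sets borel" using A by auto
      have "emeasure repr_measure (- A) + emeasure repr_measure A = emeasure repr_measure UNIV"
        using A Ab by (subst plus_emeasure) auto
      also have "\<dots> = emeasure repr_measure (- U) + emeasure repr_measure U"
        using U by (subst plus_emeasure) auto
      also have "\<dots> \<le> emeasure repr_measure (- U) + (emeasure repr_measure (- A) + ennreal d)"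
        using U Ab by (intro add_left_mono) (simp add: emeasure_repr outer_open)
      finally have "emeasure repr_measure (- A) + emeasure repr_measure A
          \<le> emeasure repr_measure (- A) + (emeasure repr_measure (- U) + ennreal d)"
        by (simp add: ac_simps)
      then have "emeasure repr_measure A \<le> emeasure repr_measure (- U) + ennreal d"
        by (simp add: ennreal_add_left_cancel_le)
      also have "\<dots> \<le> (SUP K\<in>{K. compact K \<and> K \<subseteq> A}. emeasure repr_measure K) + ennreal d"
        using K by (intro add_right_mono SUP_upper) auto
      finally show "emeasure repr_measure A \<le> (SUP K\<in>{K. compact K \<and> K \<subseteq> A}. emeasure repr_measure K) + ennreal d" .
    qed
  qed
qed

lemma integrable_repr: "continuous_on UNIV f \<Longrightarrow> integrable repr_measure (f :: 'b \<Rightarrow> real)"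
proof -
  assume f: "continuous_on UNIV f"
  interpret finite_measure repr_measure by (rule finite_measure_repr)
  have "bounded (range f)"
    using compact_continuous_image[OF f compact_UNIV] by (rule compact_imp_bounded)
  then obtain B where "\<And>x. norm (f x) \<le> B" by (auto simp: bounded_iff)
  moreover have "f \<in> borel_measurable repr_measure"
    using borel_measurable_continuous_onI[OF f] by simp
  ultimately show ?thesis by (intro integrable_const_bound[where B = B]) auto
qed

text \<open>The set {f \<noteq> 0} is open and f lies below it, so L f is at most its measure, and g
  \<ge> 1 there. This compares consecutive layers in the slicing argument.\<close>

lemma L_le_integral_of_level:
  assumes f: "continuous_on UNIV f" "\<And>x. 0 \<le> f x" "\<And>x. f x \<le> 1"
    and g: "continuous_on UNIV g" "\<And>x. 0 \<le> g x" "\<And>x. f x \<noteq> 0 \<Longrightarrow> 1 \<le> g x"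
  shows "L f \<le> (\<integral>x. g x \<partial>repr_measure)"
proof -
  interpret finite_measure repr_measure by (rule finite_measure_repr)
  let ?U = "{x. f x \<noteq> 0}"
  have U: "open ?U" using f(1) by (intro open_Collect_neq continuous_intros)
  have "ennreal (L f) \<le> emeasure repr_measure ?U"
    using U f by (auto simp: emeasure_repr outer_open intro!: L_le_open_content belowI)
  then have "L f \<le> measure repr_measure ?U"
    using nonneg[OF f(1,2)] by (simp add: emeasure_eq_measure)
  also have "\<dots> = (\<integral>x. indicator ?U x \<partial>repr_measure)" by simp
  also have "\<dots> \<le> (\<integral>x. g x \<partial>repr_measure)"
  proof (rule integral_mono)
    show "integrable repr_measure (indicat_real ?U)"
      using U by (simp add: less_top[symmetric])
    show "integrable repr_measure g" by (rule integrable_repr[OF g(1)])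
  qed (use g in \<open>auto simp: indicator_def\<close>)
  finally show ?thesis .
qed

text \<open>Slice \<open>f\<close> into \<open>n + 1\<close> layers of height \<open>1 / (n + 1)\<close>; each layer is supported where the
  previous one is full.\<close>

lemma L_le_integral:
  assumes f: "continuous_on UNIV f" "\<And>x. 0 \<le> f x" "\<And>x. f x \<le> 1"
  shows "L f \<le> (\<integral>x. f x \<partial>repr_measure)"
proof -
  interpret finite_measure repr_measure by (rule finite_measure_repr)
  note [continuous_intros] = f(1)
  have *: "L f \<le> L (\<lambda>_. 1) / Suc n + (\<integral>x. f x \<partial>repr_measure)" for n
  proof -
    define N where "N = real (Suc n)"
    have N: "0 < N" by (simp add: N_def)
    \<comment> \<open>The part of f between the heights k / N and (k + 1) / N.\<close>
    define h where "h k x = min (f x) (real (Suc k) / N) - min (f x) (real k / N)" for k x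
    have h: "continuous_on UNIV (h k)" for k
      unfolding h_def by (intro continuous_intros)
    have slice: "0 \<le> min y (a + c) - min y a" "min y (a + c) - min y a \<le> c"
      "a + c < y \<Longrightarrow> min y (a + c) - min y a = c" if "0 < c" for a c y :: real
      using that by auto
    have c: "0 < 1 / N" using N by simp
    have h_eq: "h k x = min (f x) (real k / N + 1 / N) - min (f x) (real k / N)" for k x
      by (simp add: h_def add_divide_distrib add.commute)
    have h0: "0 \<le> h k x" and h1: "N * h k x \<le> 1" for k x
      using slice(1,2)[OF c, of "f x" "real k / N"] N by (auto simp: h_eq field_simps)
    have sum_h: "(\<Sum>k<m. h k x) = min (f x) (real m / N)" for m x
      unfolding h_def using sum_lessThan_telescope[of "\<lambda>k. min (f x) (real k / N)" m] f(2)[of x] by simp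
    \<comment> \<open>If layer k + 1 is nonzero at x, then f x exceeds (k + 1) / N and layer k has
      full height 1 / N there; after scaling by N the level lemma applies.\<close>
    have step: "L (h (Suc k)) \<le> (\<integral>x. h k x \<partial>repr_measure)" for k
    proof -
      have "1 \<le> N * h k x" if "N * h (Suc k) x \<noteq> 0" for x
      proof -
        have "\<not> f x \<le> real (Suc k) / N"
        proof
          assume "f x \<le> real (Suc k) / N"
          moreover have "real (Suc k) / N \<le> real (Suc (Suc k)) / N" using N by (intro divide_right_mono) auto
          ultimately have "h (Suc k) x = 0" unfolding h_def by (simp add: min_def)
          then show False using that by simp
        qed
        then have "h k x = 1 / N"
          unfolding h_eq by (intro slice(3)[OF c]) (simp add: add_divide_distrib add.commute)
        then show ?thesis using N by simp
      qed
      then have "L (\<lambda>x. N * h (Suc k) x) \<le> (\<integral>x. N * h k x \<partial>repr_measure)"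
        using N h0 h1 by (intro L_le_integral_of_level) (auto intro!: continuous_intros h)
      then show ?thesis using N by (simp add: scale h)
    qed
    \<comment> \<open>The bottom layer has no predecessor; it is bounded by
      \<open>L (\<lambda>_. 1) / N\<close>, which disappears in the limit.\<close>
    have "L (\<lambda>x. N * h 0 x) \<le> L (\<lambda>_. 1)"
      using h1 by (intro mono) (auto intro!: continuous_intros h)
    then have h0L: "L (h 0) \<le> L (\<lambda>_. 1) / N" using N by (simp add: scale h field_simps)
    have "f x = (\<Sum>k<Suc n. h k x)" for x
      using f(3)[of x] N unfolding sum_h by (simp add: N_def min_def)
    then have "L f = L (\<lambda>x. \<Sum>k<Suc n. h k x)" by presburger
    also have "\<dots> = (\<Sum>k<Suc n. L (h k))" by (intro sum h)
    also have "\<dots> = L (h 0) + (\<Sum>k<n. L (h (Suc k)))" by (rule sum.lessThan_Suc_shift)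
    also have "\<dots> \<le> L (\<lambda>_. 1) / N + (\<Sum>k<n. \<integral>x. h k x \<partial>repr_measure)"
      using h0L step by (intro add_mono sum_mono)
    also have "(\<Sum>k<n. \<integral>x. h k x \<partial>repr_measure) = (\<integral>x. (\<Sum>k<n. h k x) \<partial>repr_measure)"
      by (rule Bochner_Integration.integral_sum[symmetric]) (intro integrable_repr h)
    also have "\<dots> \<le> (\<integral>x. f x \<partial>repr_measure)"
      unfolding sum_h by (intro integral_mono integrable_repr continuous_intros) auto
    finally show ?thesis by (simp add: N_def)
  qed
  have "(\<lambda>n. L (\<lambda>_. 1) / real (Suc n) + (\<integral>x. f x \<partial>repr_measure)) \<longlonglongrightarrow> 0 + (\<integral>x. f x \<partial>repr_measure)"
    by (intro tendsto_add tendsto_const LIMSEQ_Suc lim_const_over_n)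
  then show ?thesis using * by (intro LIMSEQ_le_const[of _ "\<integral>x. f x \<partial>repr_measure" "L f"]) auto
qed

text \<open>The one-sided estimate applied to 1 - g gives the reverse inequality because the total
  mass equals \<open>L (\<lambda>_. 1)\<close>. A general f is an affine image of a function with
  values in [0, 1].\<close>

lemma integral_repr:
  assumes f: "continuous_on UNIV f"
  shows "(\<integral>x. f x \<partial>repr_measure) = L f"
proof -
  interpret finite_measure repr_measure by (rule finite_measure_repr)
  have unit: "(\<integral>x. g x \<partial>repr_measure) = L g"
    if g [continuous_intros]: "continuous_on UNIV g" and g01: "\<And>x. 0 \<le> g x" "\<And>x. g x \<le> 1" for g
  proof (rule antisym)
    have "L (\<lambda>x. 1 + - 1 * g x) \<le> (\<integral>x. 1 + - 1 * g x \<partial>repr_measure)"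
      using g01 by (intro L_le_integral continuous_intros) auto
    moreover have "L (\<lambda>x. 1 + - 1 * g x) = L (\<lambda>_. 1) + - 1 * L g"
      using add[OF continuous_on_const[of UNIV 1] continuous_on_mult_left[OF g, of "- 1"]] scale[OF g, of "- 1"]
      by simp
    moreover have "(\<integral>x. 1 + - 1 * g x \<partial>repr_measure) = L (\<lambda>_. 1) + - 1 * (\<integral>x. g x \<partial>repr_measure)"
      using integrable_repr[OF g] by (simp add: measure_repr_UNIV)
    ultimately show "(\<integral>x. g x \<partial>repr_measure) \<le> L g" by simp
    show "L g \<le> (\<integral>x. g x \<partial>repr_measure)" using g01 by (intro L_le_integral g) auto
  qed
  have "bounded (range f)"
    using compact_continuous_image[OF f compact_UNIV] by (rule compact_imp_bounded)
  then obtain B where B: "0 < B" "\<And>x. \<bar>f x\<bar> \<le> B"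
    using bounded_pos by (metis rangeI real_norm_def)
  define g where "g x = (f x + B) / (2 * B)" for x
  have g: "continuous_on UNIV g" unfolding g_def using B f by (auto intro!: continuous_intros)
  have g01: "0 \<le> g x" "g x \<le> 1" for x
    using B(1) B(2)[of x] by (auto simp: g_def field_simps abs_le_iff)
  have fg: "f = (\<lambda>x. (2 * B) * g x + (- B))" using B by (auto simp: g_def)
  have "L f = 2 * B * L g + - B * L (\<lambda>_. 1)"
    unfolding scale[OF g, symmetric]
    by (subst fg) (intro add_const continuous_intros g)
  moreover have "(\<integral>x. f x \<partial>repr_measure) = 2 * B * (\<integral>x. g x \<partial>repr_measure) + - B * L (\<lambda>_. 1)"
    using integrable_repr[OF g] by (subst fg) (simp add: measure_repr_UNIV)
  ultimately show ?thesis using unit[OF g g01] by simp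
qed

end

section \<open>Triangle functions on the compactification\<close>

text \<open>The homeomorphism \<open>t \<mapsto> 1 / (1 + t)\<close> of \<open>[0, \<infinity>]\<close> onto \<open>[0, 1]\<close> lets us work with real-valued
  continuous functions in place of the extended metrics.\<close>

definition recip :: "ennreal \<Rightarrow> real" where
  "recip t = enn2real (inverse (1 + t))"

lemma ennreal_recip: "ennreal (recip t) = inverse (1 + t)"
proof -
  have "inverse (1 + t) \<noteq> top" by (simp add: add_eq_0_iff_both_eq_0 ennreal_inverse_eq_top_iff)
  then show ?thesis by (simp add: recip_def ennreal_enn2real_if)
qed

lemma recip_ennreal: "0 \<le> r \<Longrightarrow> recip (ennreal r) = 1 / (1 + r)"
proof -
  assume r: "0 \<le> r"
  then have *: "1 + ennreal r = ennreal (1 + r)" by (simp add: ennreal_plus)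
  have "inverse (1 + ennreal r) = ennreal (1 / (1 + r))"
    unfolding * using r by (subst inverse_ennreal) (auto simp: inverse_eq_divide)
  then show ?thesis using r by (simp add: recip_def)
qed

lemma recip_top: "recip top = 0"
  by (simp add: recip_def)

lemma recip_nonneg: "0 \<le> recip t"
  by (simp add: recip_def)

lemma recip_le_1: "recip t \<le> 1"
proof (cases t rule: ennreal_cases)
  case (real r)
  then show ?thesis by (simp add: recip_ennreal)
qed (simp add: recip_top)

lemma recip_eq_0_iff: "recip t = 0 \<longleftrightarrow> t = \<infinity>"
  by (cases t rule: ennreal_cases) (auto simp: recip_ennreal recip_top)

lemma recip_eq_1_iff: "recip t = 1 \<longleftrightarrow> t = 0"
  by (cases t rule: ennreal_cases) (auto simp: recip_ennreal recip_top)

lemma continuous_on_recip: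
  assumes "continuous_on UNIV f"
  shows "continuous_on UNIV (\<lambda>x. recip (f x))"
proof -
  have "continuous_on UNIV (\<lambda>x. inverse (1 + f x))"
    by (intro continuous_on_inverse_ennreal continuous_on_add_ennreal assms continuous_on_const)
  then have "(\<lambda>x. inverse (1 + f x)) \<midarrow>a\<rightarrow> ennreal (recip (f a))" for a
    by (simp add: continuous_on_def ennreal_recip)
  then have "(\<lambda>x. recip (f x)) \<midarrow>a\<rightarrow> recip (f a)" for a
    unfolding recip_def[of "f x" for x] by (rule tendsto_enn2real) (rule recip_nonneg[unfolded recip_def])
  then show ?thesis
    by (simp add: continuous_on_def)
qed

text \<open>Write F(t) = t / (1 + t) = 1 - 1 / (1 + t). The right side is the defect F(s) + F(t) -
  F(s + t) and the left side is F(s) F(t), so the defect is positive when s and t are. It all rests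
  on 1 + s + t \<le> (1 + s)(1 + t).\<close>

lemma strict_subadditivity:
  fixes s t :: real
  assumes "0 \<le> s" "0 \<le> t"
  shows "(1 - 1 / (1 + s)) * (1 - 1 / (1 + t)) \<le> 1 - 1 / (1 + s) - 1 / (1 + t) + 1 / (1 + (s + t))"
proof -
  have "1 / ((1 + s) * (1 + t)) \<le> 1 / (1 + (s + t))"
    using assms by (intro divide_left_mono) (auto simp: algebra_simps add_pos_nonneg)
  moreover have "(1 - a) * (1 - b) = 1 - a - b + a * b" for a b :: real
    by (simp add: algebra_simps)
  ultimately show ?thesis by simp
qed

text \<open>D is the distance to {f \<le> a}; uniform continuity keeps {b \<le> f} at a distance d
  from that set. This converts a uniformly continuous function into the nonnegative 1-Lipschitz
  functions from which quotient pseudometrics are built.\<close>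

lemma bump_of_uniformly_continuous:
  fixes f :: "'a::metric_space \<Rightarrow> real"
  assumes "uniformly_continuous_on UNIV f" and ab: "a < b"
  obtains D d where "\<And>x. 0 \<le> D x" "\<And>x y. \<bar>D x - D y\<bar> \<le> dist x y" "0 < d"
    "\<And>x. b \<le> f x \<Longrightarrow> d \<le> D x" "\<And>x. f x \<le> a \<Longrightarrow> D x = 0"
proof -
  obtain d where d: "0 < d" and fd: "\<And>x y. dist x y < d \<Longrightarrow> \<bar>f x - f y\<bar> < b - a"
    using assms unfolding uniformly_continuous_on_def dist_real_def
    by (metis UNIV_I diff_gt_0_iff_gt)
  define T where "T = {x. f x \<le> a}"
  show thesis
  proof (cases "T = {}")
    case True
    \<comment> \<open>\<open>infdist\<close> to the empty set is 0, so a constant bump is used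
      instead.\<close>
    then show ?thesis
      by (intro that[of "\<lambda>_. 1" 1]) (auto simp: T_def)
  next
    case False
    have "d \<le> infdist x T" if "b \<le> f x" for x
      unfolding infdist_notempty[OF False]
    proof (rule cINF_greatest[OF False], rule ccontr)
      fix y assume "y \<in> T" "\<not> d \<le> dist x y"
      then show False using fd[of x y] that by (auto simp: T_def)
    qed
    then show ?thesis
      using d by (intro that[of "\<lambda>x. infdist x T" d]) (auto simp: infdist_nonneg infdist_triangle_abs T_def)
  qed
qed

lemma continuous_le_of_dense:
  fixes f g :: "'b::topological_space \<Rightarrow> real"
  assumes "closure D = UNIV" "continuous_on UNIV f" "continuous_on UNIV g" "\<And>z. z \<in> D \<Longrightarrow> f z \<le> g z"
  shows "f z \<le> g z"
proof -
  have "closure D \<subseteq> {z. f z \<le> g z}"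
    using assms by (intro closure_minimal closed_Collect_le) auto
  then show ?thesis using assms(1) by auto
qed

section \<open>The two compactifications and their coordinate maps\<close>

locale pair_compactification =
  fixes z0 :: "'a::metric_space"
    and e :: "'a \<times> 'a \<Rightarrow> 'b::t2_space"
    and i :: "'a \<Rightarrow> 'c::t2_space"
    and dbar :: "'b \<Rightarrow> ennreal"
    and d0bar :: "'c \<Rightarrow> ennreal"
    and p1 p2 :: "'b \<Rightarrow> 'c"
  assumes three: "\<exists>x y w :: 'a. x \<noteq> y \<and> y \<noteq> w \<and> x \<noteq> w"
    and beta: "stone_cech_offdiag e"
    and unif: "samuel_compactification i"
    and dbar: "continuous_on UNIV dbar" "\<And>x y. x \<noteq> y \<Longrightarrow> dbar (e (x, y)) = ennreal (dist x y)"
    and d0bar: "continuous_on UNIV d0bar" "\<And>x. d0bar (i x) = ennreal (dist x z0)"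
    and p: "continuous_on UNIV p1" "continuous_on UNIV p2"
           "\<And>x y. x \<noteq> y \<Longrightarrow> p1 (e (x, y)) = i x" "\<And>x y. x \<noteq> y \<Longrightarrow> p2 (e (x, y)) = i y"
begin

lemma compact_pairs: "compact (UNIV :: 'b set)"
  using beta by (simp add: stone_cech_offdiag_def)

lemma compact_points: "compact (UNIV :: 'c set)"
  using unif by (simp add: samuel_compactification_def)

lemma continuous_le:
  fixes f g :: "'b \<Rightarrow> real"
  assumes "continuous_on UNIV f" "continuous_on UNIV g" "\<And>x y. x \<noteq> y \<Longrightarrow> f (e (x, y)) \<le> g (e (x, y))"
  shows "f z \<le> g z"
proof (rule continuous_le_of_dense[OF _ assms(1,2)])
  show "closure (e ` offdiag) = UNIV" using beta by (simp add: stone_cech_offdiag_def)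
  show "f z \<le> g z" if "z \<in> e ` offdiag" for z
    using that assms(3) by (auto simp: offdiag_def)
qed

lemma open_meets_pairs:
  assumes "open U" "z \<in> U"
  obtains x y where "x \<noteq> y" "e (x, y) \<in> U"
proof -
  have "closure (e ` offdiag) = UNIV" using beta by (simp add: stone_cech_offdiag_def)
  then have "U \<inter> e ` offdiag \<noteq> {}"
    using assms open_Int_closure_eq_empty[of U "e ` offdiag"] by auto
  then show thesis using that by (auto simp: offdiag_def)
qed

lemma extend_to_pairs:
  assumes "continuous_on offdiag (F :: 'a \<times> 'a \<Rightarrow> real)" "\<And>x y. x \<noteq> y \<Longrightarrow> \<bar>F (x, y)\<bar> \<le> B"
  obtains g where "continuous_on UNIV g" "\<And>x y. x \<noteq> y \<Longrightarrow> g (e (x, y)) = F (x, y)"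
proof -
  have "bounded (F ` offdiag)" using assms(2) by (auto simp: bounded_iff offdiag_def)
  then obtain g where "continuous_on UNIV g" "\<forall>z\<in>offdiag. g (e z) = F z"
    using beta assms(1) unfolding stone_cech_offdiag_def by blast
  then show thesis using that[of g] by (auto simp: offdiag_def)
qed

lemma extend_to_points:
  assumes "uniformly_continuous_on UNIV (f :: 'a \<Rightarrow> real)" "\<And>x. \<bar>f x\<bar> \<le> B"
  obtains g where "continuous_on UNIV g" "\<And>x. g (i x) = f x"
proof -
  have "bounded (range f)" using assms(2) by (auto simp: bounded_iff)
  then obtain g where "continuous_on UNIV g" "g \<circ> i = f"
    using unif assms(1) unfolding samuel_compactification_def by blast
  then show thesis using that[of g] by (auto simp: o_def)
qed

lemma uniformly_continuous_restrict:
  assumes "continuous_on UNIV (g :: 'c \<Rightarrow> real)"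
  shows "uniformly_continuous_on UNIV (\<lambda>x. g (i x))"
proof -
  have "bounded (range g)"
    using compact_continuous_image[OF assms compact_points] by (rule compact_imp_bounded)
  then have b: "bounded (range (g \<circ> i))" by (rule bounded_subset) auto
  then have "uniformly_continuous_on UNIV (g \<circ> i)"
    using unif assms unfolding samuel_compactification_def by blast
  then show ?thesis by (simp add: o_def)
qed

lemma continuous_bounded:
  assumes "continuous_on UNIV (g :: 'b \<Rightarrow> real)"
  obtains B where "0 < B" "\<And>z. \<bar>g z\<bar> \<le> B"
proof -
  have "bounded (range g)"
    using compact_continuous_image[OF assms compact_pairs] by (rule compact_imp_bounded)
  then obtain B where "0 < B" "\<forall>y\<in>range g. norm y \<le> B" unfolding bounded_pos by blast
  then show thesis using that[of B] by auto
qed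

section \<open>The convex cone of triangle functions\<close>

lemma GsetD_continuous: "g \<in> Gset e \<Longrightarrow> continuous_on UNIV g"
  by (simp add: Gset_def)

lemma GsetI:
  "continuous_on UNIV g \<Longrightarrow>
    (\<And>x u y. x \<noteq> u \<Longrightarrow> u \<noteq> y \<Longrightarrow> x \<noteq> y \<Longrightarrow>
      dist x y * g (e (x, y)) \<le> dist x u * g (e (x, u)) + dist u y * g (e (u, y))) \<Longrightarrow> g \<in> Gset e"
  by (simp add: Gset_def)

text \<open>The third point of the space is what makes the triangle inequality hold for \<open>x = y\<close> as well.\<close>

lemma Gset_triangle:
  assumes g: "g \<in> Gset e"
  shows "dist x y * g (e (x, y)) \<le> dist x u * g (e (x, u)) + dist u y * g (e (u, y))"
proof -
  have tri: "dist x y * g (e (x, y)) \<le> dist x u * g (e (x, u)) + dist u y * g (e (u, y))"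
    if "x \<noteq> u" "u \<noteq> y" "x \<noteq> y" for x u y
    using g that by (simp add: Gset_def)
  consider "x = u" | "u = y" | "x = y" "x \<noteq> u" | "x \<noteq> u" "u \<noteq> y" "x \<noteq> y" by blast
  then show ?thesis
  proof cases
    \<comment> \<open>The left side is 0 here. Adding the inequalities for the paths x, u, w and u,
      x, w cancels the terms at (x, w) and (u, w), leaving a nonnegative round trip between x and
      u.\<close>
    case 3
    obtain a b c :: 'a where "a \<noteq> b" "b \<noteq> c" "a \<noteq> c" using three by blast
    then obtain w where w: "w \<noteq> x" "w \<noteq> u" by metis
    have "dist x w * g (e (x, w)) \<le> dist x u * g (e (x, u)) + dist u w * g (e (u, w))"
      by (rule tri) (use 3 w in auto)
    moreover have "dist u w * g (e (u, w)) \<le> dist u x * g (e (u, x)) + dist x w * g (e (x, w))"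
      by (rule tri) (use 3 w in auto)
    ultimately show ?thesis using 3 by simp
  qed (simp_all add: tri)
qed

lemma Gset_const: "0 \<le> c \<Longrightarrow> (\<lambda>_. c) \<in> Gset e"
proof (rule GsetI)
  fix x u y :: 'a assume "0 \<le> c"
  then show "dist x y * c \<le> dist x u * c + dist u y * c"
    using mult_right_mono[OF dist_triangle[of x y u]] by (simp add: distrib_right)
qed auto

lemma Gset_add: "f \<in> Gset e \<Longrightarrow> g \<in> Gset e \<Longrightarrow> (\<lambda>z. f z + g z) \<in> Gset e"
proof (rule GsetI)
  fix x u y :: 'a assume "f \<in> Gset e" "g \<in> Gset e"
  then show "dist x y * (f (e (x, y)) + g (e (x, y)))
      \<le> dist x u * (f (e (x, u)) + g (e (x, u))) + dist u y * (f (e (u, y)) + g (e (u, y)))"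
    using Gset_triangle[of f x y u] Gset_triangle[of g x y u] by (simp add: distrib_left)
qed (auto intro!: continuous_intros dest: GsetD_continuous)

lemma Gset_scale: "0 \<le> c \<Longrightarrow> g \<in> Gset e \<Longrightarrow> (\<lambda>z. c * g z) \<in> Gset e"
proof (rule GsetI)
  fix x u y :: 'a assume "0 \<le> c" "g \<in> Gset e"
  then show "dist x y * (c * g (e (x, y))) \<le> dist x u * (c * g (e (x, u))) + dist u y * (c * g (e (u, y)))"
    using mult_left_mono[OF Gset_triangle[of g x y u], of c] by (simp add: algebra_simps)
qed (auto intro!: continuous_intros dest: GsetD_continuous)

text \<open>\<open>d g\<close> is the quotient pseudometric \<open>min (d(x,y)) (F x + F y)\<close>.\<close>

lemma Gset_quotient_metric:
  assumes F0: "\<And>x. 0 \<le> F x" and F1: "\<And>x y. \<bar>F x - F y\<bar> \<le> dist x y"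
  obtains g where "g \<in> Gset e" "\<And>z. 0 \<le> g z" "\<And>z. g z \<le> 1"
    "\<And>x y. x \<noteq> y \<Longrightarrow> g (e (x, y)) = min 1 ((F x + F y) / dist x y)"
proof -
  define G where "G z = min 1 ((F (fst z) + F (snd z)) / dist (fst z) (snd z))" for z
  have "continuous_on UNIV F"
  proof (rule lipschitz_on_continuous_on)
    show "1-lipschitz_on UNIV F" using F1 by (auto intro!: lipschitz_onI simp: dist_real_def)
  qed
  then have cF: "continuous_on offdiag (\<lambda>z. F (fst z))" "continuous_on offdiag (\<lambda>z. F (snd z))"
    by (auto intro!: continuous_on_compose2[of UNIV F] continuous_intros)
  have cG: "continuous_on offdiag G"
    unfolding G_def by (intro continuous_intros cF) (auto simp: offdiag_def)
  have G01: "0 \<le> G z" "G z \<le> 1" for z using F0 by (auto simp: G_def)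
  obtain g where g: "continuous_on UNIV g" "\<And>x y. x \<noteq> y \<Longrightarrow> g (e (x, y)) = G (x, y)"
    using extend_to_pairs[OF cG, of 1] G01 by (auto simp: abs_le_iff intro: order_trans)
  have dg: "dist x y * g (e (x, y)) = min (dist x y) (F x + F y)" if "x \<noteq> y" for x y
    using that F0 by (simp add: g G_def min_mult_distrib_left)
  have "g \<in> Gset e"
  proof (rule GsetI[OF g(1)])
    fix x u y :: 'a assume h: "x \<noteq> u" "u \<noteq> y" "x \<noteq> y"
    \<comment> \<open>If both minima on the right are values of F-sums, F u \<ge> 0 suffices; if one
      is a distance, it is absorbed by the Lipschitz bound on F; if both are, the metric triangle
      inequality applies.\<close>
    show "dist x y * g (e (x, y)) \<le> dist x u * g (e (x, u)) + dist u y * g (e (u, y))"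
      unfolding dg[OF h(1)] dg[OF h(2)] dg[OF h(3)]
      using dist_triangle[of x y u] F1[of x u] F1[of u y] F0[of x] F0[of u] F0[of y]
      by (auto simp: min_def abs_le_iff)
  qed
  moreover have "0 \<le> g z" for z
    using continuous_le[of "\<lambda>_. 0" g] g G01 by auto
  moreover have "g z \<le> 1" for z
    using continuous_le[of g "\<lambda>_. 1"] g G01 by auto
  ultimately show thesis using that[of g] g(2) by (auto simp: G_def)
qed

definition G0 :: "'b \<Rightarrow> real" where "G0 z = recip (dbar z)"

definition C0 :: "'c \<Rightarrow> real" where "C0 \<xi> = recip (d0bar \<xi>)"

lemma continuous_G0: "continuous_on UNIV G0"
  unfolding G0_def by (intro continuous_on_recip dbar)

lemma continuous_C0: "continuous_on UNIV C0"
  unfolding C0_def by (intro continuous_on_recip d0bar)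

lemma G0_pair: "x \<noteq> y \<Longrightarrow> G0 (e (x, y)) = 1 / (1 + dist x y)"
  by (simp add: G0_def dbar recip_ennreal)

lemma dist_mult_G0: "x \<noteq> y \<Longrightarrow> dist x y * G0 (e (x, y)) = 1 - 1 / (1 + dist x y)"
proof -
  assume "x \<noteq> y"
  have "a * (1 / (1 + a)) = 1 - 1 / (1 + a)" if "0 \<le> a" for a :: real
    using that by (simp add: field_simps)
  from this[of "dist x y"] show "dist x y * G0 (e (x, y)) = 1 - 1 / (1 + dist x y)"
    unfolding G0_pair[OF \<open>x \<noteq> y\<close>] by simp
qed

lemma C0_point: "C0 (i x) = 1 / (1 + dist x z0)"
  by (simp add: C0_def d0bar recip_ennreal)

lemma G0_nonneg: "0 \<le> G0 z" and G0_le_1: "G0 z \<le> 1"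
  by (auto simp: G0_def recip_nonneg recip_le_1)

text \<open>A continuous f separating p1 z from p2 z is uniformly continuous on the space, so it
  varies little on pairs at distance below d. Near z there are such pairs on which f still jumps;
  \<open>1 / (1 + d) < G0 z\<close> is the open condition expressing the small distance.\<close>

lemma coordinates_eq_of_dbar_0:
  assumes "dbar z = 0"
  shows "p1 z = p2 z"
proof (rule ccontr)
  assume "p1 z \<noteq> p2 z"
  then have "\<exists>f :: 'c \<Rightarrow> real. continuous_on UNIV f \<and> (\<forall>x. 0 \<le> f x \<and> f x \<le> 1) \<and>
      (\<forall>x\<in>{p1 z}. f x = 0) \<and> (\<forall>x\<in>{p2 z}. f x = 1)"
    by (intro Urysohn_compact_space[OF compact_points]) auto
  then obtain f :: "'c \<Rightarrow> real" where f: "continuous_on UNIV f" "f (p1 z) = 0" "f (p2 z) = 1" by auto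
  obtain d where d: "0 < d" and fd: "\<And>x y. dist x y < d \<Longrightarrow> dist (f (i x)) (f (i y)) < 1/2"
    using uniformly_continuous_restrict[OF f(1)] unfolding uniformly_continuous_on_def
    by (metis UNIV_I half_gt_zero zero_less_one)
  have cf: "continuous_on UNIV (\<lambda>z. f (p1 z))" "continuous_on UNIV (\<lambda>z. f (p2 z))"
    using p by (auto intro!: continuous_on_compose2[OF f(1)])
  have "open ({z. 1 / (1 + d) < G0 z} \<inter> {z. f (p1 z) < 1/4} \<inter> {z. 3/4 < f (p2 z)})"
    by (intro open_Int open_Collect_less continuous_intros continuous_G0 cf)
  moreover have "z \<in> {z. 1 / (1 + d) < G0 z} \<inter> {z. f (p1 z) < 1/4} \<inter> {z. 3/4 < f (p2 z)}"
    using f d assms recip_eq_1_iff[of 0] by (simp add: G0_def)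
  ultimately obtain x y where xy: "x \<noteq> y"
    "e (x, y) \<in> {z. 1 / (1 + d) < G0 z} \<inter> {z. f (p1 z) < 1/4} \<inter> {z. 3/4 < f (p2 z)}"
    using open_meets_pairs by blast
  then have "dist x y < d" "f (i x) < 1/4" "3/4 < f (i y)"
    using d by (auto simp: G0_pair p divide_simps add_pos_nonneg split: if_splits)
  then show False using fd[of x y] by (simp add: dist_real_def)
qed

end

section \<open>Concentration away from infinity\<close>

lemma radonD:
  assumes "radon \<mu>"
  shows "sets \<mu> = sets borel" "space \<mu> = UNIV" "finite_measure \<mu>"
proof -
  show s: "sets \<mu> = sets borel" using assms by (simp add: radon_def)
  then show "space \<mu> = UNIV" using sets_eq_imp_space_eq[of \<mu> borel] by simp
  show "finite_measure \<mu>" using assms by (intro finite_measureI) (auto simp: radon_def)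
qed

lemma radon_compact_approx:
  assumes "radon \<mu>" "A \<in> sets borel" "0 < d"
  obtains K where "compact K" "K \<subseteq> A" "measure \<mu> A < measure \<mu> K + d"
proof -
  interpret finite_measure \<mu> using assms(1) by (rule radonD)
  have eq: "emeasure \<mu> A = (SUP K \<in> {K. compact K \<and> K \<subseteq> A}. emeasure \<mu> K)"
    using assms by (simp add: radon_def)
  show thesis
  proof (cases "measure \<mu> A < d")
    case True
    then show ?thesis using that[of "{}"] by simp
  next
    case False
    then have "ennreal (measure \<mu> A - d) < emeasure \<mu> A"
      using assms(3) unfolding emeasure_eq_measure by (intro ennreal_lessI) auto
    then obtain K where K: "compact K" "K \<subseteq> A" "ennreal (measure \<mu> A - d) < emeasure \<mu> K"
      unfolding eq by (auto simp: less_SUP_iff)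
    then have "measure \<mu> A - d < measure \<mu> K"
      using False by (simp add: emeasure_eq_measure ennreal_less_iff)
    then show ?thesis using that K by auto
  qed
qed

lemma concentrated_on_iff_AE: "concentrated_on \<mu> C \<longleftrightarrow> (AE z in \<mu>. z \<in> C)"
  unfolding concentrated_on_def eventually_ae_filter null_sets_def by (auto simp: set_diff_eq)

context pair_compactification
begin

lemma integrable_continuous:
  assumes "radon \<mu>" "continuous_on UNIV (f :: 'b \<Rightarrow> real)"
  shows "integrable \<mu> f"
proof -
  interpret finite_measure \<mu> using assms(1) by (rule radonD)
  obtain B where "\<And>z. \<bar>f z\<bar> \<le> B" using continuous_bounded[OF assms(2)] by blast
  moreover have "f \<in> borel_measurable \<mu>"
    using borel_measurable_continuous_onI[OF assms(2)] radonD(1)[OF assms(1)]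
    by (simp cong: measurable_cong_sets)
  ultimately show ?thesis by (intro integrable_const_bound[where B = B]) auto
qed

text \<open>Since g n is 1 on N, \<mu> N \<le> \<integral>g n d\<mu> \<le> \<integral>g n d\<nu>.
  The last integral is at most \<nu> W plus the integral over the complement of W, which tends to 0
  by dominated convergence.\<close>

lemma measure_le_of_Gset_limit:
  assumes \<mu>: "radon \<mu>" and \<nu>: "radon \<nu>" and le: "preceq e \<mu> \<nu>"
    and g: "\<And>n::nat. g n \<in> Gset e" "\<And>n z. 0 \<le> g n z" "\<And>n z. g n z \<le> 1"
    and N: "N \<in> sets borel" "\<And>n z. z \<in> N \<Longrightarrow> g n z = 1"
    and W: "W \<in> sets borel" "AE z in \<nu>. z \<notin> W \<longrightarrow> (\<lambda>n. g n z) \<longlonglongrightarrow> 0"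
  shows "measure \<mu> N \<le> measure \<nu> W"
proof -
  interpret M: finite_measure \<mu> using \<mu> by (rule radonD)
  interpret N: finite_measure \<nu> using \<nu> by (rule radonD)
  note [simp] = radonD(1,2)[OF \<mu>] radonD(1,2)[OF \<nu>]
  have ig: "integrable \<mu> (g n)" "integrable \<nu> (g n)" for n
    using \<mu> \<nu> g(1) by (auto intro: integrable_continuous GsetD_continuous)
  have iN: "integrable \<mu> (indicat_real N)" using N by (simp add: less_top[symmetric])
  have iW: "integrable \<nu> (indicat_real W)" using W by (simp add: less_top[symmetric])
  define k where "k n z = g n z * indicator (- W) z" for n z
  have mk: "k n \<in> borel_measurable \<nu>" for n
    unfolding k_def using ig(2) W by (intro borel_measurable_times borel_measurable_indicator) auto
  have k1: "norm (k n z) \<le> 1" for n z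
    using g(2,3) by (auto simp: k_def indicator_def)
  have ik: "integrable \<nu> (k n)" for n
    using mk k1 by (intro N.integrable_const_bound[where B = 1]) auto
  have *: "measure \<mu> N \<le> measure \<nu> W + (\<integral>z. k n z \<partial>\<nu>)" for n
  proof -
    have "measure \<mu> N = (\<integral>z. indicator N z \<partial>\<mu>)" by simp
    also have "\<dots> \<le> (\<integral>z. g n z \<partial>\<mu>)"
      using g N by (intro integral_mono iN ig) (auto simp: indicator_def)
    also have "\<dots> \<le> (\<integral>z. g n z \<partial>\<nu>)" using le g(1) by (simp add: preceq_def)
    also have "\<dots> \<le> (\<integral>z. indicator W z + k n z \<partial>\<nu>)"
      using g by (intro integral_mono ig Bochner_Integration.integrable_add iW ik) (auto simp: k_def indicator_def)
    also have "\<dots> = measure \<nu> W + (\<integral>z. k n z \<partial>\<nu>)"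
      using iW ik by simp
    finally show ?thesis .
  qed
  have "(\<lambda>n. \<integral>z. k n z \<partial>\<nu>) \<longlonglongrightarrow> (\<integral>z. 0 \<partial>\<nu>)"
  proof (rule integral_dominated_convergence[where w = "\<lambda>_. 1"])
    show "AE z in \<nu>. (\<lambda>n. k n z) \<longlonglongrightarrow> 0"
      using W(2) by eventually_elim (auto simp: k_def indicator_def)
  qed (use mk k1 in auto)
  then have "(\<lambda>n. measure \<nu> W + (\<integral>z. k n z \<partial>\<nu>)) \<longlonglongrightarrow> measure \<nu> W + 0"
    by (intro tendsto_add tendsto_const) simp
  then show ?thesis using LIMSEQ_le_const[of _ "measure \<nu> W + 0" "measure \<mu> N"] * by auto
qed

text \<open>The test functions come from collapsing the ball of radius n around z0. They equal 1
  wherever a coordinate lies at infinity and are eventually 0 at any element with both coordinates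
  finite.\<close>

lemma preceq_concentrated_finite:
  assumes \<mu>: "radon \<mu>" and \<nu>: "radon \<nu>" and le: "preceq e \<mu> \<nu>"
    and conc: "AE z in \<nu>. d0bar (p1 z) < \<infinity> \<and> d0bar (p2 z) < \<infinity>"
  shows "AE z in \<mu>. d0bar (p1 z) < \<infinity> \<and> d0bar (p2 z) < \<infinity>"
proof -
  have cC: "continuous_on UNIV (\<lambda>z. C0 (p1 z))" "continuous_on UNIV (\<lambda>z. C0 (p2 z))"
    using p by (auto intro!: continuous_on_compose2[OF continuous_C0])
  define F where "F n x = max 0 (dist x z0 - real n)" for n :: nat and x :: 'a
  have "\<exists>g. g \<in> Gset e \<and> (\<forall>z. 0 \<le> g z \<and> g z \<le> 1) \<and>
      (\<forall>x y. x \<noteq> y \<longrightarrow> g (e (x, y)) = min 1 ((F n x + F n y) / dist x y))" for n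
  proof -
    have "\<bar>F n x - F n y\<bar> \<le> dist x y" for x y
      using dist_triangle[of x z0 y] dist_triangle[of y z0 x]
      by (auto simp: F_def max_def dist_commute abs_le_iff)
    then show ?thesis by (rule_tac Gset_quotient_metric[of "F n"]) (auto simp: F_def)
  qed
  then obtain g where g: "\<And>n. g n \<in> Gset e" "\<And>n z. 0 \<le> g n z" "\<And>n z. g n z \<le> 1"
    and g_pair: "\<And>n x y. x \<noteq> y \<Longrightarrow> g n (e (x, y)) = min 1 ((F n x + F n y) / dist x y)"
    by metis
  note cg = GsetD_continuous[OF g(1)]
  \<comment> \<open>With D = d(x,z0) + d(y,z0), the F-sum is at least D - 2n while d(x,y) \<le> D,
    so 1 - g is at most 2n / D.\<close>
  have far: "(1 - g n (e (x, y))) * (dist x z0 + dist y z0) \<le> 2 * real n" if "x \<noteq> y" for n x y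
  proof -
    define D where "D = dist x z0 + dist y z0"
    have "0 < dist x y" "dist x y \<le> D"
      using that dist_triangle2[of x y z0] by (auto simp: D_def)
    then have D: "dist x y \<le> D" "0 < dist x y" "0 < D" by linarith+
    have S: "D - 2 * real n \<le> F n x + F n y" "0 \<le> F n x + F n y"
      by (auto simp: F_def D_def)
    have "(F n x + F n y) / D \<le> (F n x + F n y) / dist x y"
      using D S by (intro divide_left_mono mult_pos_pos) auto
    moreover have "1 - 2 * real n / D \<le> (F n x + F n y) / D"
      using divide_right_mono[OF S(1), of D] D by (simp add: diff_divide_distrib)
    ultimately have "1 - g n (e (x, y)) \<le> 2 * real n / D"
      using D unfolding g_pair[OF that] by (auto simp: min_def)
    then show ?thesis using D unfolding D_def[symmetric] by (simp add: field_simps)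
  qed
  \<comment> \<open>Dividing by 1 + a turns the unbounded estimate into one between continuous
    functions on the compactification. Where C0 vanishes it reads 1 - g \<le> 0.\<close>
  have far_limit: "(1 - g n z) * (1 - C0 (q z)) \<le> 2 * real n * C0 (q z)"
    if q: "continuous_on UNIV (\<lambda>z. C0 (q z))"
      and q_pair: "\<And>x y. x \<noteq> y \<Longrightarrow> \<exists>w. q (e (x, y)) = i w \<and> dist w z0 \<le> dist x z0 + dist y z0" for n z q
  proof (rule continuous_le)
    fix x y :: 'a assume xy: "x \<noteq> y"
    obtain w where w: "q (e (x, y)) = i w" "dist w z0 \<le> dist x z0 + dist y z0"
      using q_pair[OF xy] by blast
    define a where "a = dist w z0"
    have a: "0 \<le> a" by (simp add: a_def)
    have "(1 - g n (e (x, y))) * a \<le> (1 - g n (e (x, y))) * (dist x z0 + dist y z0)"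
      using g(3) w(2) by (intro mult_left_mono) (auto simp: a_def)
    then have "(1 - g n (e (x, y))) * a \<le> 2 * real n" using far[OF xy, of n] by linarith
    then have "(1 - g n (e (x, y))) * a / (1 + a) \<le> 2 * real n / (1 + a)"
      using a by (intro divide_right_mono) auto
    moreover have "1 - 1 / (1 + a) = a / (1 + a)" using a by (simp add: field_simps)
    ultimately show "(1 - g n (e (x, y))) * (1 - C0 (q (e (x, y)))) \<le> 2 * real n * C0 (q (e (x, y)))"
      by (simp add: w(1) C0_point a_def)
  qed (intro continuous_intros cg q)+
  have far1: "(1 - g n z) * (1 - C0 (p1 z)) \<le> 2 * real n * C0 (p1 z)" for n z
    by (rule far_limit[OF cC(1)]) (auto simp: p)
  have far2: "(1 - g n z) * (1 - C0 (p2 z)) \<le> 2 * real n * C0 (p2 z)" for n z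
    by (rule far_limit[OF cC(2)]) (auto simp: p)
  \<comment> \<open>The implication from C0 > 1 / (1 + n) at both coordinates to g = 0 is not itself
    an inequality between continuous functions; the product with positive parts makes it one, so it
    passes to the closure. The same encoding recurs below.\<close>
  have near: "g n z * (max 0 (C0 (p1 z) - 1 / (1 + real n)) * max 0 (C0 (p2 z) - 1 / (1 + real n))) \<le> 0" for n z
  proof (rule continuous_le)
    fix x y :: 'a assume xy: "x \<noteq> y"
    have small: "F n x = 0" if "1 / (1 + real n) < C0 (i x)" for x
      using that by (simp add: C0_point F_def divide_simps add_pos_nonneg split: if_splits)
    show "g n (e (x, y)) * (max 0 (C0 (p1 (e (x, y))) - 1 / (1 + real n)) * max 0 (C0 (p2 (e (x, y))) - 1 / (1 + real n))) \<le> 0"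
    proof (cases "1 / (1 + real n) < C0 (i x) \<and> 1 / (1 + real n) < C0 (i y)")
      case True
      then show ?thesis using small[of x] small[of y] xy by (simp add: g_pair)
    next
      case False
      then show ?thesis using xy by (auto simp: p not_less max_def)
    qed
  qed (intro continuous_intros cg cC)+
  define N where "N = {z. C0 (p1 z) \<le> 0} \<union> {z. C0 (p2 z) \<le> 0}"
  have N_iff: "z \<notin> N \<longleftrightarrow> d0bar (p1 z) < \<infinity> \<and> d0bar (p2 z) < \<infinity>" for z
    using recip_nonneg[of "d0bar (p1 z)"] recip_nonneg[of "d0bar (p2 z)"]
    by (auto simp: N_def C0_def less_top recip_eq_0_iff order_antisym_conv)
  have N: "N \<in> sets borel"
    unfolding N_def by (intro borel_closed closed_Un closed_Collect_le continuous_intros cC)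
  have "measure \<mu> N \<le> measure \<nu> {}"
  proof (rule measure_le_of_Gset_limit[OF \<mu> \<nu> le g N])
    show "g n z = 1" if "z \<in> N" for n z
    proof -
      have "C0 (p1 z) = 0 \<or> C0 (p2 z) = 0"
        using that recip_nonneg by (auto simp: N_def C0_def intro: antisym)
      then show ?thesis using far1[of n z] far2[of n z] g(3)[of n z] by auto
    qed
    show "AE z in \<nu>. z \<notin> {} \<longrightarrow> (\<lambda>n. g n z) \<longlonglongrightarrow> 0"
      using conc
    proof eventually_elim
      case (elim z)
      then have "0 < min (C0 (p1 z)) (C0 (p2 z))"
        using N_iff[of z] by (auto simp: N_def)
      then obtain m :: nat where m: "1 / (1 + real m) < min (C0 (p1 z)) (C0 (p2 z))"
        using nat_approx_posE by (metis of_nat_Suc add.commute)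
      have "g n z = 0" if "m \<le> n" for n
      proof -
        have "1 / (1 + real n) \<le> 1 / (1 + real m)" using that by (simp add: frac_le)
        then have "0 < max 0 (C0 (p1 z) - 1 / (1 + real n)) * max 0 (C0 (p2 z) - 1 / (1 + real n))"
          using m by (intro mult_pos_pos) auto
        then show ?thesis using near[of n z] g(2)[of n z] by (metis antisym mult_le_0_iff not_less)
      qed
      then have "\<forall>\<^sub>F n in sequentially. g n z = 0" by (auto simp: eventually_sequentially)
      then show ?case by (simp add: tendsto_eventually)
    qed
  qed simp
  then have "measure \<mu> N = 0" by (simp add: measure_le_0_iff)
  moreover interpret finite_measure \<mu> using \<mu> by (rule radonD)
  have "N \<in> sets \<mu>" using N radonD[OF \<mu>] by simp
  ultimately have "N \<in> null_sets \<mu>" by (simp add: null_sets_def emeasure_eq_measure)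
  then have "AE z in \<mu>. z \<notin> N" by (rule AE_not_in)
  then show ?thesis by (simp add: N_iff)
qed

end

section \<open>Concentration away from the diagonal\<close>

context pair_compactification
begin

lemma closed_dbar_0: "closed {z. dbar z = 0}"
proof -
  have "{z. dbar z = 0} = {z. G0 z = 1}" by (simp add: G0_def recip_eq_1_iff)
  also have "closed \<dots>" by (intro closed_Collect_eq continuous_intros continuous_G0)
  finally show ?thesis .
qed

lemma diagonal_closed:
  assumes "closed K"
  shows "closed {z. dbar z = 0 \<and> p1 z \<in> K}"
proof -
  have "closed (p1 -` K)" using assms p(1) by (simp add: closed_vimage)
  then have "closed ({z. dbar z = 0} \<inter> p1 -` K)"
    using closed_dbar_0 by (rule closed_Int[rotated])
  then show ?thesis by (simp add: Int_def vimage_def)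
qed

text \<open>The test functions belong to the pseudometrics \<open>min (d(x,y)) (F x + F y)\<close>, where \<open>F\<close> is a small
  multiple of a bump around \<open>K\<close>: they tend to the indicator of a neighbourhood of \<open>K\<close> on the diagonal.\<close>

lemma diagonal_test_functions:
  fixes \<phi> :: "'c \<Rightarrow> real"
  assumes \<phi>: "continuous_on UNIV \<phi>"
  obtains g where "\<And>n::nat. g n \<in> Gset e" "\<And>n z. 0 \<le> g n z" "\<And>n z. g n z \<le> 1"
    "\<And>n z. dbar z = 0 \<Longrightarrow> 3/4 < \<phi> (p1 z) \<Longrightarrow> g n z = 1"
    "\<And>n z. \<phi> (p1 z) < 1/4 \<Longrightarrow> \<phi> (p2 z) < 1/4 \<Longrightarrow> g n z = 0"
    "\<And>z. dbar z \<noteq> 0 \<Longrightarrow> (\<lambda>n. g n z) \<longlonglongrightarrow> 0"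
proof -
  have c\<phi>: "continuous_on UNIV (\<lambda>z. \<phi> (p1 z))" "continuous_on UNIV (\<lambda>z. \<phi> (p2 z))"
    using p by (auto intro!: continuous_on_compose2[OF \<phi>])
  obtain D d where D0: "\<And>x. 0 \<le> D x" and D1: "\<And>x y. \<bar>D x - D y\<bar> \<le> dist x y" and d: "0 < d"
    and D_big: "\<And>x. 3/4 \<le> \<phi> (i x) \<Longrightarrow> d \<le> D x" and D_zero: "\<And>x. \<phi> (i x) \<le> 1/4 \<Longrightarrow> D x = 0"
    using bump_of_uniformly_continuous[OF uniformly_continuous_restrict[OF \<phi>], of "1/4" "3/4"] by auto
  \<comment> \<open>The truncation heights shrink to 0 but never exceed d, so the truncated bump
    equals r n wherever \<phi> \<ge> 3/4.\<close>
  define r where "r n = d / real (Suc n)" for n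
  have r: "0 < r n" "r n \<le> d" for n
    using d by (auto simp: r_def field_simps)
  define F where "F n x = min (D x) (r n)" for n x
  have F0: "0 \<le> F n x" "F n x \<le> r n" for n x using D0[of x] r[of n] by (auto simp: F_def)
  have F1: "\<bar>F n x - F n y\<bar> \<le> dist x y" for n x y
    using D1[of x y] by (auto simp: F_def min_def abs_le_iff)
  have "\<exists>g. g \<in> Gset e \<and> (\<forall>z. 0 \<le> g z \<and> g z \<le> 1) \<and>
      (\<forall>x y. x \<noteq> y \<longrightarrow> g (e (x, y)) = min 1 ((F n x + F n y) / dist x y))" for n
    by (rule Gset_quotient_metric[of "F n"]) (use F0 F1 in auto)
  then obtain g where g: "\<And>n. g n \<in> Gset e" "\<And>n z. 0 \<le> g n z" "\<And>n z. g n z \<le> 1"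
    and g_pair: "\<And>n x y. x \<noteq> y \<Longrightarrow> g n (e (x, y)) = min 1 ((F n x + F n y) / dist x y)"
    by metis
  note cg = GsetD_continuous[OF g(1)]
  have one: "(1 - g n z) * (max 0 (\<phi> (p1 z) - 3/4) * max 0 (G0 z - 1 / (1 + r n))) \<le> 0" for n z
  proof (rule continuous_le)
    fix x y :: 'a assume xy: "x \<noteq> y"
    show "(1 - g n (e (x, y))) * (max 0 (\<phi> (p1 (e (x, y))) - 3/4) * max 0 (G0 (e (x, y)) - 1 / (1 + r n))) \<le> 0"
    proof (cases "3/4 < \<phi> (i x) \<and> 1 / (1 + r n) < 1 / (1 + dist x y)")
      case True
      then have "F n x = r n" using D_big[of x] r(2)[of n] by (simp add: F_def)
      moreover have "dist x y < r n"
        using True r(1)[of n] by (simp add: divide_simps add_pos_nonneg split: if_splits)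
      ultimately have "1 \<le> (F n x + F n y) / dist x y"
        using xy F0[of n y] by simp
      then have "g n (e (x, y)) = 1" unfolding g_pair[OF xy] by simp
      then show ?thesis by simp
    next
      case False
      then have "max 0 (\<phi> (p1 (e (x, y))) - 3/4) = 0 \<or> max 0 (G0 (e (x, y)) - 1 / (1 + r n)) = 0"
        using xy by (auto simp: p G0_pair)
      then show ?thesis by auto
    qed
  qed (intro continuous_intros cg c\<phi> continuous_G0)+
  have zero: "g n z * (max 0 (1/4 - \<phi> (p1 z)) * max 0 (1/4 - \<phi> (p2 z))) \<le> 0" for n z
  proof (rule continuous_le)
    fix x y :: 'a assume xy: "x \<noteq> y"
    show "g n (e (x, y)) * (max 0 (1/4 - \<phi> (p1 (e (x, y)))) * max 0 (1/4 - \<phi> (p2 (e (x, y))))) \<le> 0"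
    proof (cases "\<phi> (i x) < 1/4 \<and> \<phi> (i y) < 1/4")
      case True
      then have "F n x = 0" "F n y = 0" using D_zero[of x] D_zero[of y] r(1)[of n] by (auto simp: F_def)
      then show ?thesis using xy by (simp add: g_pair)
    next
      case False
      then have "max 0 (1/4 - \<phi> (p1 (e (x, y)))) = 0 \<or> max 0 (1/4 - \<phi> (p2 (e (x, y)))) = 0"
        using xy by (auto simp: p)
      then show ?thesis by auto
    qed
  qed (intro continuous_intros cg c\<phi>)+
  \<comment> \<open>From g d \<le> 2 r n and 1 - G0 \<le> d on pairs; away from d = 0 the factor 1 -
    G0 is positive, which gives convergence to 0.\<close>
  have small: "g n z * (1 - G0 z) \<le> 2 * r n" for n z
  proof (rule continuous_le)
    fix x y :: 'a assume xy: "x \<noteq> y"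
    have "g n (e (x, y)) \<le> (F n x + F n y) / dist x y" unfolding g_pair[OF xy] by simp
    also have "\<dots> \<le> 2 * r n / dist x y"
      using F0(2)[of n x] F0(2)[of n y] by (intro divide_right_mono) auto
    finally have "g n (e (x, y)) * dist x y \<le> 2 * r n" using xy by (simp add: field_simps)
    moreover have "1 - 1 / (1 + t) \<le> t" if "0 \<le> t" for t :: real
      using that by (simp add: field_simps)
    then have "1 - G0 (e (x, y)) \<le> dist x y" unfolding G0_pair[OF xy] by simp
    then have "g n (e (x, y)) * (1 - G0 (e (x, y))) \<le> g n (e (x, y)) * dist x y"
      using g(2) by (intro mult_left_mono) auto
    ultimately show "g n (e (x, y)) * (1 - G0 (e (x, y))) \<le> 2 * r n" by linarith
  qed (intro continuous_intros cg continuous_G0)+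
  show thesis
  proof (rule that[of g])
    fix n z
    show "g n \<in> Gset e" "0 \<le> g n z" "g n z \<le> 1" using g by auto
    show "g n z = 1" if "dbar z = 0" "3/4 < \<phi> (p1 z)"
    proof -
      have "G0 z = 1" using that by (simp add: G0_def recip_eq_1_iff)
      then have "0 < max 0 (\<phi> (p1 z) - 3/4) * max 0 (G0 z - 1 / (1 + r n))"
        using that r(1)[of n] by (intro mult_pos_pos) auto
      then show ?thesis using one[of n z] g(3)[of n z] by (auto simp: mult_le_0_iff)
    qed
    show "g n z = 0" if "\<phi> (p1 z) < 1/4" "\<phi> (p2 z) < 1/4"
    proof -
      have "0 < max 0 (1/4 - \<phi> (p1 z)) * max 0 (1/4 - \<phi> (p2 z))"
        using that by (intro mult_pos_pos) auto
      then show ?thesis using zero[of n z] g(2)[of n z] by (auto simp: mult_le_0_iff)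
    qed
  next
    fix z assume "dbar z \<noteq> 0"
    then have G: "0 < 1 - G0 z"
      using recip_eq_1_iff[of "dbar z"] G0_le_1[of z] by (auto simp: G0_def)
    have "(\<lambda>n. inverse (real (Suc n))) \<longlonglongrightarrow> 0" by (rule LIMSEQ_inverse_real_of_nat)
    then have "(\<lambda>n. 2 * d / (1 - G0 z) * inverse (real (Suc n))) \<longlonglongrightarrow> 2 * d / (1 - G0 z) * 0"
      by (intro tendsto_mult tendsto_const)
    then have lim: "(\<lambda>n. 2 * r n / (1 - G0 z)) \<longlonglongrightarrow> 0"
      by (simp add: r_def field_simps)
    have "g n z \<le> 2 * r n / (1 - G0 z)" for n
      using small[of n z] G by (simp add: field_simps)
    then show "(\<lambda>n. g n z) \<longlonglongrightarrow> 0"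
      using g(2) by (intro tendsto_sandwich[OF _ _ tendsto_const lim]) auto
  qed
qed

text \<open>A compact L avoiding the diagonal over K carries all but \<epsilon> of \<nu>. The
  diagonal part of L projects onto a compact Q disjoint from K, and \<phi> separates Q from K. The
  test functions are then 1 on the diagonal over K and tend to 0 on all of L, on its diagonal part
  because both coordinates lie in Q.\<close>

lemma preceq_diagonal_compact:
  assumes \<mu>: "radon \<mu>" and \<nu>: "radon \<nu>" and le: "preceq e \<mu> \<nu>"
    and K: "closed K" and null: "measure \<nu> {z. dbar z = 0 \<and> p1 z \<in> K} = 0"
  shows "measure \<mu> {z. dbar z = 0 \<and> p1 z \<in> K} = 0"
proof -
  interpret finite_measure \<nu> using \<nu> by (rule radonD)
  define N where "N = {z. dbar z = 0 \<and> p1 z \<in> K}"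
  have N: "closed N" unfolding N_def using K by (rule diagonal_closed)
  have "measure \<mu> N \<le> 0 + \<epsilon>" if "0 < \<epsilon>" for \<epsilon>
  proof -
    have "- N \<in> sets borel" using N by auto
    then obtain L where L: "compact L" "L \<subseteq> - N" "measure \<nu> (- N) < measure \<nu> L + \<epsilon>"
      using radon_compact_approx[OF \<nu> _ \<open>0 < \<epsilon>\<close>] by blast
    have cL: "closed L" using L(1) by (rule compact_imp_closed)
    have "measure \<nu> (- N) = measure \<nu> UNIV" "measure \<nu> (- L) = measure \<nu> UNIV - measure \<nu> L"
      using finite_measure_compl[of N] finite_measure_compl[of L] N cL null radonD[OF \<nu>]
      by (auto simp: N_def Compl_eq_Diff_UNIV)
    with L(3) have W: "measure \<nu> (- L) \<le> \<epsilon>" by simp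
    define Q where "Q = p1 ` ({z. dbar z = 0} \<inter> L)"
    have "compact ({z. dbar z = 0} \<inter> L)"
      using closed_dbar_0 L(1) by (rule closed_Int_compact)
    then have Q: "closed Q"
      unfolding Q_def using p(1)
      by (intro compact_imp_closed compact_continuous_image continuous_on_subset[OF p(1)]) auto
    have "Q \<inter> K = {}" using L(2) by (auto simp: Q_def N_def)
    from Urysohn_compact_space[OF compact_points Q K this]
    obtain \<phi> :: "'c \<Rightarrow> real" where \<phi>: "continuous_on UNIV \<phi>" "\<forall>x\<in>Q. \<phi> x = 0" "\<forall>x\<in>K. \<phi> x = 1"
      by auto
    obtain g where g: "\<And>n::nat. g n \<in> Gset e" "\<And>n z. 0 \<le> g n z" "\<And>n z. g n z \<le> 1"
      and g1: "\<And>n z. dbar z = 0 \<Longrightarrow> 3/4 < \<phi> (p1 z) \<Longrightarrow> g n z = 1"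
      and g0: "\<And>n z. \<phi> (p1 z) < 1/4 \<Longrightarrow> \<phi> (p2 z) < 1/4 \<Longrightarrow> g n z = 0"
      and glim: "\<And>z. dbar z \<noteq> 0 \<Longrightarrow> (\<lambda>n. g n z) \<longlonglongrightarrow> 0"
      using diagonal_test_functions[OF \<phi>(1)] by blast
    have "measure \<mu> N \<le> measure \<nu> (- L)"
    proof (rule measure_le_of_Gset_limit[OF \<mu> \<nu> le g])
      show "N \<in> sets borel" "- L \<in> sets borel" using N cL by auto
      show "g n z = 1" if "z \<in> N" for n z using that \<phi>(3) by (intro g1) (auto simp: N_def)
      show "AE z in \<nu>. z \<notin> - L \<longrightarrow> (\<lambda>n. g n z) \<longlonglongrightarrow> 0"
      proof (intro AE_I2 impI)
        fix z assume z: "z \<notin> - L"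
        show "(\<lambda>n. g n z) \<longlonglongrightarrow> 0"
        proof (cases "dbar z = 0")
          case True
          then have "p1 z \<in> Q" using z by (auto simp: Q_def)
          moreover have "p2 z = p1 z" using coordinates_eq_of_dbar_0[OF True] by simp
          ultimately have "\<phi> (p1 z) = 0" "\<phi> (p2 z) = 0" using \<phi>(2) by auto
          then show ?thesis using g0 by simp
        qed (rule glim)
      qed
    qed
    with W show ?thesis by simp
  qed
  then have "measure \<mu> N \<le> 0" by (rule field_le_epsilon)
  then show ?thesis by (simp add: N_def measure_le_0_iff)
qed

text \<open>Inner regularity of \<mu> gives a compact L in the diagonal over A. Its projection K is
  a compact subset of A, and the diagonal over K lies between L and the diagonal over A, so it is
  null for \<nu> and the closed case applies.\<close>

lemma preceq_diagonal:
  assumes \<mu>: "radon \<mu>" and \<nu>: "radon \<nu>" and le: "preceq e \<mu> \<nu>"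
    and A: "A \<in> sets borel" and null: "AE z in \<nu>. \<not> (dbar z = 0 \<and> p1 z \<in> A)"
  shows "AE z in \<mu>. \<not> (dbar z = 0 \<and> p1 z \<in> A)"
proof -
  interpret M: finite_measure \<mu> using \<mu> by (rule radonD)
  interpret N: finite_measure \<nu> using \<nu> by (rule radonD)
  note [simp] = radonD(1,2)[OF \<mu>] radonD(1,2)[OF \<nu>]
  define E where "E = {z. dbar z = 0 \<and> p1 z \<in> A}"
  have "p1 -` A \<inter> space borel \<in> sets borel"
    using borel_measurable_continuous_onI[OF p(1)] A by (rule measurable_sets)
  then have "{z. dbar z = 0} \<inter> (p1 -` A) \<in> sets borel"
    by (intro sets.Int borel_closed[OF closed_dbar_0]) simp
  then have E: "E \<in> sets borel" by (simp add: E_def Int_def vimage_def)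
  have \<nu>E: "AE z in \<nu>. z \<notin> E" using null by (simp add: E_def)
  have "measure \<mu> E \<le> 0 + \<epsilon>" if \<epsilon>: "0 < \<epsilon>" for \<epsilon>
  proof -
    obtain L where L: "compact L" "L \<subseteq> E" "measure \<mu> E < measure \<mu> L + \<epsilon>"
      using radon_compact_approx[OF \<mu> E \<epsilon>] .
    define K where "K = p1 ` L"
    have K: "closed K"
      unfolding K_def using L(1) p(1)
      by (intro compact_imp_closed compact_continuous_image continuous_on_subset[OF p(1)]) auto
    define N where "N = {z. dbar z = 0 \<and> p1 z \<in> K}"
    have N: "N \<in> sets borel" "N \<subseteq> E" "L \<subseteq> N"
      using diagonal_closed[OF K] L(2) by (auto simp: N_def K_def E_def)
    have "AE z in \<nu>. z \<notin> N" using \<nu>E by eventually_elim (use N(2) in auto)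
    then have "measure \<nu> N = 0" using N(1) by (simp add: AE_iff_measurable[OF _ refl] measure_def)
    then have "measure \<mu> N = 0"
      unfolding N_def by (rule preceq_diagonal_compact[OF \<mu> \<nu> le K])
    moreover have "measure \<mu> L \<le> measure \<mu> N" using N by (intro M.finite_measure_mono) auto
    ultimately show ?thesis using L(3) by simp
  qed
  then have "measure \<mu> E \<le> 0" by (rule field_le_epsilon)
  then have "measure \<mu> E = 0" by (simp add: measure_le_0_iff)
  then have "E \<in> null_sets \<mu>" using E by (simp add: null_sets_def M.emeasure_eq_measure)
  then have "AE z in \<mu>. z \<notin> E" by (rule AE_not_in)
  then show ?thesis by (simp add: E_def)
qed

end

section \<open>Minimal measures\<close>

context pair_compactification
begin

text \<open>Let X be the set of second coordinates of pairs in V. The truncated distance to X is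
  bounded and uniformly continuous, so it extends to the Samuel compactification; the extension
  vanishes at p2 a, which is p1 b, and pairs in W close to b therefore start close to X.\<close>

lemma adjacent_pairs:
  assumes V: "open V" "a \<in> V" and W: "open W" "b \<in> W" and ab: "p2 a = p1 b" and \<eta>: "0 < \<eta>"
  obtains x u u' y where "x \<noteq> u" "u' \<noteq> y" "e (x, u) \<in> V" "e (u', y) \<in> W" "dist u u' < \<eta>"
proof -
  define X where "X = {u. \<exists>x. x \<noteq> u \<and> e (x, u) \<in> V}"
  obtain x u where "x \<noteq> u" "e (x, u) \<in> V" using open_meets_pairs[OF V] .
  then have "X \<noteq> {}" by (auto simp: X_def)
  define f where "f u = min \<eta> (infdist u X)" for u
  have "1-lipschitz_on UNIV f"
    using infdist_triangle_abs[of _ X]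
    by (intro lipschitz_onI) (auto simp: f_def dist_real_def min_def abs_le_iff, (smt (verit))+)
  then have "uniformly_continuous_on UNIV f" by (rule lipschitz_on_uniformly_continuous)
  moreover have "\<bar>f u\<bar> \<le> \<eta>" for u using \<eta> infdist_nonneg[of u X] by (auto simp: f_def)
  ultimately obtain h where h: "continuous_on UNIV h" "\<And>u. h (i u) = f u"
    using extend_to_points by blast
  have ch: "continuous_on UNIV (\<lambda>z. h (p1 z))" "continuous_on UNIV (\<lambda>z. h (p2 z))"
    using p by (auto intro!: continuous_on_compose2[OF h(1)])
  have "h (p2 a) = 0"
  proof (rule ccontr)
    assume "h (p2 a) \<noteq> 0"
    moreover have "open ({z. h (p2 z) \<noteq> 0} \<inter> V)"
      using V by (intro open_Int open_Collect_neq continuous_intros ch)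
    ultimately obtain x u where xu: "x \<noteq> u" "e (x, u) \<in> {z. h (p2 z) \<noteq> 0} \<inter> V"
      using open_meets_pairs[of "{z. h (p2 z) \<noteq> 0} \<inter> V" a] V by blast
    then have "u \<in> X" by (auto simp: X_def)
    then have "f u = 0" using \<eta> by (simp add: f_def)
    then show False using xu by (simp add: p h)
  qed
  then have "b \<in> {z. h (p1 z) < \<eta>} \<inter> W" using ab W \<eta> by simp
  moreover have "open ({z. h (p1 z) < \<eta>} \<inter> W)"
    using W by (intro open_Int open_Collect_less continuous_intros ch)
  ultimately obtain u' y where uy: "u' \<noteq> y" "e (u', y) \<in> {z. h (p1 z) < \<eta>} \<inter> W"
    using open_meets_pairs by blast
  then have "infdist u' X < \<eta>" by (auto simp: p h f_def min_def split: if_splits)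
  then have "\<exists>u\<in>X. dist u' u < \<eta>"
    unfolding infdist_notempty[OF \<open>X \<noteq> {}\<close>] by (subst (asm) cINF_less_iff) (use \<open>X \<noteq> {}\<close> in auto)
  then show thesis using that uy by (auto simp: X_def dist_commute)
qed

text \<open>Strict subadditivity of \<open>t / (1 + t)\<close> makes a triangle function dominating \<open>- G0\<close> exceed \<open>- G0\<close>
  by a definite amount on one of two adjacent elements.\<close>

lemma adjacent_gap:
  assumes g: "g \<in> Gset e" and pos: "\<And>z. 0 \<le> G0 z + g z" and ab: "p2 a = p1 b"
    and r: "0 < r" "r < G0 a" "r < G0 b"
  shows "(1 - G0 a) * (1 - G0 b) \<le> (G0 a + g a) / r + (G0 b + g b) / r"
proof -
  define h where "h z = G0 z + g z" for z
  have ch: "continuous_on UNIV h"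
    unfolding h_def using g by (intro continuous_intros continuous_G0 GsetD_continuous)
  obtain B where B: "0 < B" "\<And>z. \<bar>h z\<bar> \<le> B" using continuous_bounded[OF ch] by blast
  \<comment> \<open>Error budget: one \<epsilon> for each of the two values of h, one for the jump
    from u to u', and two for replacing G0 at a and b by its values at the nearby pairs.\<close>
  have "(1 - G0 a) * (1 - G0 b) \<le> h a / r + h b / r + 5 * \<epsilon>" if \<epsilon>: "0 < \<epsilon>" for \<epsilon>
  proof -
    define U where "U c = {z. r < G0 z} \<inter> {z. h z / r < h c / r + \<epsilon>} \<inter> {z. G0 z < G0 c + \<epsilon>}" for c
    have "continuous_on UNIV (\<lambda>z. h z / r)"
      using r(1) ch by (intro continuous_on_divide continuous_on_const) auto
    then have U: "open (U c)" for c
      unfolding U_def by (intro open_Int open_Collect_less continuous_on_const continuous_G0)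
    have aU: "a \<in> U a" and bU: "b \<in> U b" using r \<epsilon> by (auto simp: U_def)
    have \<eta>: "0 < \<epsilon> / B" using \<epsilon> B by simp
    obtain x u u' y where "x \<noteq> u" "u' \<noteq> y" "e (x, u) \<in> U a" "e (u', y) \<in> U b"
      and uu': "dist u u' < \<epsilon> / B"
      using adjacent_pairs[OF U aU U bU ab \<eta>] .
    then have xu: "x \<noteq> u" "e (x, u) \<in> U a" and uy: "u' \<noteq> y" "e (u', y) \<in> U b" by auto
    define s where "s = dist x u"
    define t where "t = dist u' y"
    define \<tau> where "\<tau> = dist u u'"
    have st: "0 \<le> s" "0 \<le> t" "0 \<le> \<tau>" by (auto simp: s_def t_def \<tau>_def)
    \<comment> \<open>\<open>r < G0\<close> bounds the distance by 1 / r, so the weight in the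
      triangle inequality can be traded for the factor 1 / r.\<close>
    have H_le: "dist x y * h (e (x, y)) \<le> h (e (x, y)) / r" if "r < G0 (e (x, y))" "x \<noteq> y" for x y
    proof -
      have "r * (1 + dist x y) < 1"
        using that by (simp add: G0_pair field_simps add_pos_nonneg)
      then have "r * dist x y \<le> 1" using r(1) by (simp add: distrib_left)
      then have "dist x y \<le> 1 / r" using r(1) by (simp add: field_simps)
      from mult_right_mono[OF this, of "h (e (x, y))"] show ?thesis
        using pos by (simp add: h_def)
    qed
    have 1: "s * h (e (x, u)) \<le> h a / r + \<epsilon>" and 2: "t * h (e (u', y)) \<le> h b / r + \<epsilon>"
      using H_le[of x u] H_le[of u' y] xu uy by (auto simp: U_def s_def t_def)
    have "\<tau> * h (e (u, u')) \<le> \<tau> * B"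
      using B(2)[of "e (u, u')"] st by (intro mult_left_mono) auto
    also have "\<dots> \<le> \<epsilon>" using uu' B(1) by (simp add: \<tau>_def field_simps)
    finally have 3: "\<tau> * h (e (u, u')) \<le> \<epsilon>" .
    have w: "dist v w * G0 (e (v, w)) = 1 - 1 / (1 + dist v w)" for v w
      by (cases "v = w") (simp_all add: dist_mult_G0)
    have h_split: "dist v w * h (e (v, w)) = 1 - 1 / (1 + dist v w) + dist v w * g (e (v, w))" for v w
      using w[of v w] by (simp add: h_def distrib_left)
    \<comment> \<open>The path x, u, u', y. Writing g = h - G0 and using h \<ge> 0 at (x, y), what
      remains on the left is the subadditivity defect of t / (1 + t) along the path.\<close>
    have "dist x y * g (e (x, y)) \<le> dist x u * g (e (x, u)) + dist u y * g (e (u, y))"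
      by (rule Gset_triangle[OF g])
    moreover have "dist u y * g (e (u, y)) \<le> dist u u' * g (e (u, u')) + dist u' y * g (e (u', y))"
      by (rule Gset_triangle[OF g])
    moreover have "0 \<le> dist x y * h (e (x, y))" using pos by (simp add: h_def)
    ultimately have 4: "(1 - 1 / (1 + s)) + (1 - 1 / (1 + \<tau>)) + (1 - 1 / (1 + t)) - (1 - 1 / (1 + dist x y))
        \<le> s * h (e (x, u)) + \<tau> * h (e (u, u')) + t * h (e (u', y))"
      using h_split[of x y] h_split[of x u] h_split[of u u'] h_split[of u' y]
      unfolding s_def[symmetric] t_def[symmetric] \<tau>_def[symmetric] by linarith
    \<comment> \<open>The defect is split as s + t against \<tau>, which contributes a nonnegative
      amount, and s against t, which contributes the desired product.\<close>
    have "dist x y \<le> s + t + \<tau>"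
      using dist_triangle[of x y u] dist_triangle[of u y u'] by (simp add: s_def t_def \<tau>_def)
    then have "1 / (1 + (s + t + \<tau>)) \<le> 1 / (1 + dist x y)"
      by (intro divide_left_mono) (auto intro!: mult_pos_pos add_pos_nonneg simp: st)
    moreover have "0 \<le> (1 - 1 / (1 + (s + t))) * (1 - 1 / (1 + \<tau>))"
      using st by (intro mult_nonneg_nonneg) auto
    moreover have "0 \<le> s + t" using st by simp
    note strict_subadditivity[OF this st(3)]
    moreover note strict_subadditivity[OF st(1,2)]
    ultimately have 5: "(1 - 1 / (1 + s)) * (1 - 1 / (1 + t))
        \<le> (1 - 1 / (1 + s)) + (1 - 1 / (1 + \<tau>)) + (1 - 1 / (1 + t)) - (1 - 1 / (1 + dist x y))"
      by linarith
    define P where "P = 1 - 1 / (1 + s)"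
    define Q where "Q = 1 - 1 / (1 + t)"
    have PQ: "1 - G0 a - \<epsilon> \<le> P" "1 - G0 b - \<epsilon> \<le> Q"
      using xu uy by (auto simp: U_def G0_pair P_def Q_def s_def t_def)
    have P01: "0 \<le> P" "P \<le> 1" using st by (auto simp: P_def)
    have "(1 - G0 a) * (1 - G0 b) \<le> (P + \<epsilon>) * (1 - G0 b)"
      using PQ G0_le_1[of b] by (intro mult_right_mono) auto
    also have "\<dots> = P * (1 - G0 b) + \<epsilon> * (1 - G0 b)" by (simp add: distrib_right)
    also have "\<dots> \<le> P * (Q + \<epsilon>) + \<epsilon> * 1"
      using PQ P01 \<epsilon> G0_nonneg[of b] by (intro add_mono mult_left_mono) auto
    also have "\<dots> \<le> P * Q + 2 * \<epsilon>"
      using mult_right_mono[OF P01(2), of \<epsilon>] \<epsilon> by (simp add: distrib_left)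
    finally have "(1 - G0 a) * (1 - G0 b) \<le> P * Q + 2 * \<epsilon>" .
    then show ?thesis using 1 2 3 4 5 unfolding P_def Q_def by linarith
  qed
  then have "(1 - G0 a) * (1 - G0 b) \<le> h a / r + h b / r + \<epsilon>" if "0 < \<epsilon>" for \<epsilon>
    using that by (metis mult.commute nonzero_eq_divide_eq zero_less_divide_iff zero_less_numeral zero_neq_numeral)
  then show ?thesis unfolding h_def by (rule field_le_epsilon)
qed

text \<open>A linear functional below the sublinear functional \<open>f \<mapsto> inf {\<integral>g d\<nu> | g \<in> G, g \<ge> f}\<close> is positive and
  precedes \<open>\<nu>\<close>; touching it at \<open>- G0\<close> makes it minimal with respect to \<open>G0\<close>.\<close>

lemma G0_minimal_below:
  assumes \<nu>: "radon \<nu>"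
  obtains \<mu> where "radon \<mu>" "preceq e \<mu> \<nu>"
    "\<And>\<epsilon>. 0 < \<epsilon> \<Longrightarrow> \<exists>g\<in>Gset e. (\<forall>z. 0 \<le> G0 z + g z) \<and> (\<integral>z. G0 z + g z \<partial>\<mu>) \<le> \<epsilon>"
proof -
  define S where "S f = {g \<in> Gset e. \<forall>z. apply_bcontfun f z \<le> g z}" for f :: "('b, real) bcontfun"
  define q where "q f = (INF g\<in>S f. \<integral>z. g z \<partial>\<nu>)" for f
  have int: "integrable \<nu> f" if "continuous_on UNIV f" for f :: "'b \<Rightarrow> real"
    using \<nu> that by (rule integrable_continuous)
  \<comment> \<open>Together with the lower bound by the integral of f, this makes q a genuine real
    infimum; a constant function belongs to the cone by the metric triangle inequality.\<close>
  have S_ne: "S f \<noteq> {}" for f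
  proof -
    have "(\<lambda>_. norm f) \<in> S f"
      using norm_bounded[of f] by (auto simp: S_def abs_le_iff intro: Gset_const)
    then show ?thesis by blast
  qed
  have ge: "(\<integral>z. apply_bcontfun f z \<partial>\<nu>) \<le> (\<integral>z. g z \<partial>\<nu>)" if "g \<in> S f" for f g
    using that by (intro integral_mono int) (auto simp: S_def dest: GsetD_continuous)
  have bdd: "bdd_below ((\<lambda>g. \<integral>z. g z \<partial>\<nu>) ` S f)" for f
    using ge by (intro bdd_belowI2)
  have q_le: "q f \<le> (\<integral>z. g z \<partial>\<nu>)" if "g \<in> S f" for f g
    unfolding q_def using bdd that by (rule cINF_lower)
  have le_q: "c \<le> q f" if "\<And>g. g \<in> S f \<Longrightarrow> c \<le> (\<integral>z. g z \<partial>\<nu>)" for c f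
    unfolding q_def using S_ne that by (rule cINF_greatest)
  have "sublinear q"
  proof (rule sublinearI)
    have "q 0 \<le> (\<integral>z. (\<lambda>_. 0) z \<partial>\<nu>)"
      by (rule q_le) (auto simp: S_def intro: Gset_const)
    moreover have "0 \<le> q 0" using ge[of _ 0] by (intro le_q) simp
    ultimately show "q 0 = 0" by simp
  next
    fix f f'
    have "q (f + f') \<le> (\<integral>z. g z \<partial>\<nu>) + (\<integral>z. g' z \<partial>\<nu>)" if "g \<in> S f" "g' \<in> S f'" for g g'
    proof -
      have "(\<lambda>z. g z + g' z) \<in> S (f + f')"
        using that by (auto simp: S_def plus_bcontfun.rep_eq intro: Gset_add add_mono)
      then have "q (f + f') \<le> (\<integral>z. g z + g' z \<partial>\<nu>)" by (rule q_le)
      also have "\<dots> = (\<integral>z. g z \<partial>\<nu>) + (\<integral>z. g' z \<partial>\<nu>)"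
        using that by (intro Bochner_Integration.integral_add int) (auto simp: S_def dest: GsetD_continuous)
      finally show ?thesis .
    qed
    then have "q (f + f') - (\<integral>z. g z \<partial>\<nu>) \<le> q f'" if "g \<in> S f" for g
      using that by (intro le_q) (simp add: diff_le_eq add.commute[of _ "integral\<^sup>L \<nu> g"])
    then have "q (f + f') - q f' \<le> q f" by (intro le_q) (simp add: algebra_simps)
    then show "q (f + f') \<le> q f + q f'" by simp
  next
    fix c :: real and f assume c: "0 < c"
    have "q (c *\<^sub>R f) / c \<le> (\<integral>z. g z \<partial>\<nu>)" if "g \<in> S f" for g
    proof -
      have "(\<lambda>z. c * g z) \<in> S (c *\<^sub>R f)"
        using that c by (auto simp: S_def scaleR_bcontfun.rep_eq intro: Gset_scale)
      then have "q (c *\<^sub>R f) \<le> (\<integral>z. c * g z \<partial>\<nu>)" by (rule q_le)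
      then show ?thesis using c by (simp add: field_simps)
    qed
    then have "q (c *\<^sub>R f) / c \<le> q f" by (rule le_q)
    then show "q (c *\<^sub>R f) \<le> c * q f" using c by (simp add: field_simps)
  qed
  \<comment> \<open>Hahn--Banach acts on a real vector space type, so continuous functions are
    passed through bounded continuous ones.\<close>
  define bc :: "('b \<Rightarrow> real) \<Rightarrow> ('b, real) bcontfun" where "bc = Bcontfun"
  have bc: "apply_bcontfun (bc f) = f" if f: "continuous_on UNIV f" for f
  proof -
    obtain B where "\<And>z. \<bar>f z\<bar> \<le> B" using continuous_bounded[OF f] by blast
    then have "f \<in> bcontfun" using f by (intro bcontfun_normI) auto
    then show ?thesis by (simp add: bc_def Bcontfun_inverse)
  qed
  obtain m where m: "linear m" "m \<le> q" "m (bc (\<lambda>z. - G0 z)) = q (bc (\<lambda>z. - G0 z))"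
    using hahn_banach_sublinear[OF \<open>sublinear q\<close>] .
  have mq: "m f \<le> q f" for f using m(2) by (simp add: le_fun_def)
  interpret L: positive_functional "\<lambda>f. m (bc f)"
  proof
    show "compact (UNIV :: 'b set)" by (rule compact_pairs)
  next
    fix f g :: "'b \<Rightarrow> real" assume fg: "continuous_on UNIV f" "continuous_on UNIV g"
    have "bc (\<lambda>x. f x + g x) = bc f + bc g"
      using fg by (intro bcontfun_eqI) (simp add: bc continuous_on_add plus_bcontfun.rep_eq)
    then show "m (bc (\<lambda>x. f x + g x)) = m (bc f) + m (bc g)" using m(1) by (simp add: linear_add)
  next
    fix f :: "'b \<Rightarrow> real" and c assume f: "continuous_on UNIV f"
    have "bc (\<lambda>x. c * f x) = c *\<^sub>R bc f"
      using f by (intro bcontfun_eqI) (simp add: bc continuous_on_mult_left scaleR_bcontfun.rep_eq)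
    then show "m (bc (\<lambda>x. c * f x)) = c * m (bc f)" using m(1) by (simp add: linear_scale)
  next
    fix f :: "'b \<Rightarrow> real" assume f: "continuous_on UNIV f" "\<And>x. 0 \<le> f x"
    \<comment> \<open>The zero function is in the cone and dominates - f, so q is at most 0 at -
      f.\<close>
    have "m (- bc f) \<le> q (- bc f)" by (rule mq)
    also have "\<dots> \<le> (\<integral>z. (\<lambda>_. 0) z \<partial>\<nu>)"
      using f by (intro q_le) (auto simp: S_def bc uminus_bcontfun.rep_eq intro: Gset_const)
    finally show "0 \<le> m (bc f)" using m(1) by (simp add: linear_neg)
  qed
  have rep: "(\<integral>z. f z \<partial>L.repr_measure) = m (bc f)" if "continuous_on UNIV f" for f
    using that by (rule L.integral_repr)
  have le: "(\<integral>z. g z \<partial>L.repr_measure) \<le> (\<integral>z. g z \<partial>\<nu>)" if g: "g \<in> Gset e" for g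
  proof -
    have "m (bc g) \<le> q (bc g)" by (rule mq)
    also have "\<dots> \<le> (\<integral>z. g z \<partial>\<nu>)"
      using g by (intro q_le) (simp add: S_def bc GsetD_continuous)
    finally show ?thesis by (simp add: rep GsetD_continuous[OF g])
  qed
  show thesis
  proof (rule that[OF L.radon_repr])
    show "preceq e L.repr_measure \<nu>" using le by (simp add: preceq_def)
    fix \<epsilon> :: real assume \<epsilon>: "0 < \<epsilon>"
    let ?f = "bc (\<lambda>z. - G0 z)"
    have cG: "continuous_on UNIV (\<lambda>z. - G0 z)" by (intro continuous_intros continuous_G0)
    \<comment> \<open>A near-optimal g for q(- G0). Since \<integral>g d\<mu> \<le> \<integral>g
      d\<nu> and q(- G0) = - \<integral>G0 d\<mu>, the integral of G0 + g against \<mu> is at most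
      \<epsilon>.\<close>
    have "(INF g\<in>S ?f. \<integral>z. g z \<partial>\<nu>) < q ?f + \<epsilon>" using \<epsilon> by (simp add: q_def)
    then obtain g where g: "g \<in> S ?f" "(\<integral>z. g z \<partial>\<nu>) < q ?f + \<epsilon>"
      by (subst (asm) cINF_less_iff[OF S_ne bdd]) blast
    have gG: "g \<in> Gset e" and pos: "\<And>z. - G0 z \<le> g z" using g(1) by (auto simp: S_def bc[OF cG])
    have "q ?f = (\<integral>z. - G0 z \<partial>L.repr_measure)" using m(3) rep[OF cG] by simp
    then have "(\<integral>z. g z \<partial>L.repr_measure) \<le> \<epsilon> - (\<integral>z. G0 z \<partial>L.repr_measure)"
      using le[OF gG] g(2) by simp
    moreover have "(\<integral>z. G0 z + g z \<partial>L.repr_measure) = (\<integral>z. G0 z \<partial>L.repr_measure) + (\<integral>z. g z \<partial>L.repr_measure)"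
      by (intro Bochner_Integration.integral_add L.integrable_repr continuous_G0 GsetD_continuous gG)
    ultimately have "(\<integral>z. G0 z + g z \<partial>L.repr_measure) \<le> \<epsilon>" by simp
    moreover have "0 \<le> G0 z + g z" for z using pos[of z] by linarith
    ultimately show "\<exists>g\<in>Gset e. (\<forall>z. 0 \<le> G0 z + g z) \<and> (\<integral>z. G0 z + g z \<partial>L.repr_measure) \<le> \<epsilon>"
      using gG by blast
  qed
qed

end

section \<open>Mutual singularity of the marginals\<close>

context pair_compactification
begin

text \<open>At stage k the element z is bad if \<open>h k z\<close> is at least c k; bad sets have
  summable measure by Markov's inequality. On the region K k, which stays away from d = 0 and d =
  \<infinity>, two good elements cannot be adjacent, so the p2-image B k of the good part contains
  no p1 z with z in K k good. The limit inferior of the B k separates the coordinates almost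
  everywhere.\<close>

lemma singular_coordinates:
  assumes \<mu>: "radon \<mu>"
    and min: "\<And>\<epsilon>. 0 < \<epsilon> \<Longrightarrow> \<exists>g\<in>Gset e. (\<forall>z. 0 \<le> G0 z + g z) \<and> (\<integral>z. G0 z + g z \<partial>\<mu>) \<le> \<epsilon>"
  obtains B where "B \<in> sets borel" "AE z in \<mu>. 0 < G0 z \<and> G0 z < 1 \<longrightarrow> p2 z \<in> B \<and> p1 z \<notin> B"
proof -
  interpret finite_measure \<mu> using \<mu> by (rule radonD)
  note [simp] = radonD(1,2)[OF \<mu>]
  define r where "r k = 1 / real (k + 2)" for k :: nat
  have r: "0 < r k" for k by (simp add: r_def)
  \<comment> \<open>On K k adjacency forces the two values of h to sum to at least 4 (r k)^3, that
    is 16 c k, so both cannot be at most c k.\<close>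
  define c where "c k = r k ^ 3 / 4" for k
  have c: "0 < c k" for k using r by (simp add: c_def)
  have "\<exists>g. g \<in> Gset e \<and> (\<forall>z. 0 \<le> G0 z + g z) \<and> (\<integral>z. G0 z + g z \<partial>\<mu>) \<le> c k * (1/2) ^ k" for k
    using min[of "c k * (1/2) ^ k"] c[of k] by auto
  then obtain g where g: "\<And>k. g k \<in> Gset e" and pos: "\<And>k z. 0 \<le> G0 z + g k z"
    and small: "\<And>k. (\<integral>z. G0 z + g k z \<partial>\<mu>) \<le> c k * (1/2) ^ k"
    by metis
  define h where "h k z = G0 z + g k z" for k z
  have ch: "continuous_on UNIV (h k)" for k
    unfolding h_def using g by (intro continuous_intros continuous_G0 GsetD_continuous)
  define Z where "Z k = {z. c k \<le> h k z}" for k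
  have Zb: "Z k \<in> sets borel" for k
    unfolding Z_def by (intro borel_closed closed_Collect_le continuous_intros ch)
  have Zm: "measure \<mu> (Z k) \<le> (1/2) ^ k" for k
  proof -
    have "c k * measure \<mu> (Z k) = (\<integral>z. c k * indicator (Z k) z \<partial>\<mu>)" by simp
    also have "\<dots> \<le> (\<integral>z. h k z \<partial>\<mu>)"
    proof (rule integral_mono)
      show "integrable \<mu> (\<lambda>z. c k * indicat_real (Z k) z)"
        using Zb by (intro integrable_mult_right) (simp add: less_top[symmetric])
      show "integrable \<mu> (h k)" using \<mu> ch by (rule integrable_continuous)
      show "c k * indicat_real (Z k) z \<le> h k z" for z
        using pos[of z k] by (auto simp: Z_def h_def indicator_def)
    qed
    also have "\<dots> \<le> c k * (1/2) ^ k" using small by (simp add: h_def)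
    finally show ?thesis using c[of k] by simp
  qed
  define K where "K k = {z. 2 * r k \<le> G0 z} \<inter> {z. G0 z \<le> 1 - 2 * r k}" for k
  \<comment> \<open>The good part is defined with \<le>, hence compact, so its image is closed and
    no measurability of images is in question.\<close>
  define B where "B k = p2 ` (K k \<inter> {z. h k z \<le> c k})" for k
  have "closed (K k \<inter> {z. h k z \<le> c k})" for k
    unfolding K_def by (intro closed_Int closed_Collect_le continuous_on_const continuous_G0 ch)
  then have "compact (K k \<inter> {z. h k z \<le> c k})" for k
    using compact_Int_closed[OF compact_pairs] by simp
  then have "closed (B k)" for k
    unfolding B_def
    by (intro compact_imp_closed compact_continuous_image continuous_on_subset[OF p(2)]) auto
  then have Bb: "B k \<in> sets borel" for k by (rule borel_closed)
  have sep: "z \<in> Z k" if z: "z \<in> K k" "p1 z \<in> B k" for z k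
  proof -
    obtain a where a: "a \<in> K k" "h k a \<le> c k" "p2 a = p1 z" using z by (auto simp: B_def)
    have rK: "r k < G0 w" "2 * r k \<le> 1 - G0 w" if "w \<in> K k" for w
      using that r[of k] by (auto simp: K_def)
    have "(2 * r k) * (2 * r k) \<le> (1 - G0 a) * (1 - G0 z)"
      using rK(2)[OF a(1)] rK(2)[OF z(1)] r[of k] by (intro mult_mono) auto
    also have "\<dots> \<le> h k a / r k + h k z / r k"
      unfolding h_def using g pos a(3) r rK(1)[OF a(1)] rK(1)[OF z(1)] by (intro adjacent_gap)
    finally have "4 * r k ^ 3 \<le> h k a + h k z"
      using r[of k] by (simp add: field_simps power3_eq_cube)
    then show ?thesis
      using a(2) zero_less_power[OF r[of k], of 3] unfolding Z_def c_def mem_Collect_eq by linarith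
  qed
  have ev: "AE z in \<mu>. eventually (\<lambda>k. z \<in> space \<mu> - Z k) sequentially"
  proof (rule borel_cantelli_AE1)
    show "summable (\<lambda>k. measure \<mu> (Z k))"
      by (rule summable_comparison_test'[OF summable_geometric[of "1/2"], of 0]) (use Zm in auto)
  qed (use Zb in \<open>auto simp: less_top[symmetric]\<close>)
  \<comment> \<open>Almost every z with 0 < G0 z < 1 is eventually good and in K k, so p2 z is in
    all late B k, whereas p1 z misses all late B k and thus every tail intersection.\<close>
  define Binf where "Binf = (\<Union>m. \<Inter>k\<in>{m..}. B k)"
  have "Binf \<in> sets borel"
    unfolding Binf_def using Bb by (intro sets.countable_UN sets.countable_INT') auto
  moreover have "AE z in \<mu>. 0 < G0 z \<and> G0 z < 1 \<longrightarrow> p2 z \<in> Binf \<and> p1 z \<notin> Binf"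
    using ev
  proof eventually_elim
    case (elim z)
    show ?case
    proof
      assume "0 < G0 z \<and> G0 z < 1"
      then have lim: "0 < min (G0 z) (1 - G0 z) / 2" by simp
      have "r \<longlonglongrightarrow> 0"
        unfolding r_def using LIMSEQ_ignore_initial_segment[OF lim_1_over_n, of 2] by simp
      then have "eventually (\<lambda>k. r k < min (G0 z) (1 - G0 z) / 2) sequentially"
        using lim by (rule order_tendstoD(2))
      with elim have "eventually (\<lambda>k. p2 z \<in> B k \<and> p1 z \<notin> B k) sequentially"
      proof eventually_elim
        case (elim k)
        then have "z \<in> K k" "z \<notin> Z k" by (auto simp: K_def)
        then show ?case using sep by (auto simp: B_def Z_def)
      qed
      then obtain m where m: "\<And>k. m \<le> k \<Longrightarrow> p2 z \<in> B k \<and> p1 z \<notin> B k"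
        by (auto simp: eventually_sequentially)
      have "p1 z \<notin> (\<Inter>k\<in>{n..}. B k)" for n
        using m[of "max m n"] by auto
      then show "p2 z \<in> Binf \<and> p1 z \<notin> Binf" using m by (auto simp: Binf_def)
    qed
  qed
  ultimately show thesis by (rule that)
qed

text \<open>The inequality 1 + d(x,y) \<le> (1 + d(x,z0)) (1 + d(y,z0)) survives on the
  compactification in the reciprocal form C0 C0 \<le> G0.\<close>

lemma dbar_finite:
  assumes "d0bar (p1 z) < \<infinity>" "d0bar (p2 z) < \<infinity>"
  shows "dbar z < \<infinity>"
proof -
  have cC: "continuous_on UNIV (\<lambda>z. C0 (p1 z))" "continuous_on UNIV (\<lambda>z. C0 (p2 z))"
    using p by (auto intro!: continuous_on_compose2[OF continuous_C0])
  have "C0 (p1 z) * C0 (p2 z) \<le> G0 z"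
  proof (rule continuous_le)
    fix x y :: 'a assume xy: "x \<noteq> y"
    define a where "a = dist x z0"
    define b where "b = dist y z0"
    have ab: "0 \<le> a" "0 \<le> b" by (auto simp: a_def b_def)
    have "dist x y \<le> a + b" using dist_triangle2[of x y z0] by (simp add: a_def b_def)
    moreover have "1 + (a + b) \<le> (1 + a) * (1 + b)" using ab by (simp add: algebra_simps)
    ultimately have "1 + dist x y \<le> (1 + a) * (1 + b)" by linarith
    then have "1 / ((1 + a) * (1 + b)) \<le> 1 / (1 + dist x y)"
      using ab by (intro divide_left_mono mult_pos_pos) (auto intro!: add_pos_nonneg)
    then show "C0 (p1 (e (x, y))) * C0 (p2 (e (x, y))) \<le> G0 (e (x, y))"
      using xy by (simp add: p C0_point G0_pair a_def b_def)
  qed (intro continuous_intros cC continuous_G0)+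
  moreover have "C0 (p1 z) \<noteq> 0" "C0 (p2 z) \<noteq> 0" using assms by (auto simp: C0_def recip_eq_0_iff)
  then have "0 < C0 (p1 z) * C0 (p2 z)"
    using recip_nonneg by (intro mult_pos_pos) (auto simp: C0_def order_less_le)
  ultimately have "recip (dbar z) \<noteq> 0" by (simp add: G0_def)
  then show ?thesis by (simp add: recip_eq_0_iff less_top)
qed

lemma preceq_mnorm:
  assumes "radon \<mu>" "radon \<nu>" "preceq e \<mu> \<nu>"
  shows "mnorm \<mu> \<le> mnorm \<nu>"
proof -
  have "(\<lambda>_. 1) \<in> Gset e" by (rule Gset_const) simp
  with assms(3) have "(\<integral>z. (1 :: real) \<partial>\<mu>) \<le> (\<integral>z. 1 \<partial>\<nu>)"
    unfolding preceq_def by (rule bspec)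
  then show ?thesis by (simp add: mnorm_def)
qed

end

text \<open>Multiplied by the distance, a slope becomes f x - f y, which telescopes: the triangle
  inequality is an equality, so both signs qualify. The order then forces equal integrals of
  slopes.\<close>

lemma Lip0_slope_in_Gset:
  assumes "continuous_on UNIV h" "\<forall>x y. x \<noteq> y \<longrightarrow> h (e (x, y)) = (f x - f y) / dist x y"
  shows "h \<in> Gset e" "(\<lambda>z. - h z) \<in> Gset e"
  using assms by (auto simp: Gset_def intro!: continuous_intros)

theorem theorem4p11:
  fixes z0 :: "'a::complete_space"
    and e :: "'a \<times> 'a \<Rightarrow> 'b::t2_space"
    and i :: "'a \<Rightarrow> 'c::t2_space"
    and Phi :: "('a \<Rightarrow> real) \<Rightarrow> 'b \<Rightarrow> real"
    and dbar :: "'b \<Rightarrow> ennreal"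
    and d0bar :: "'c \<Rightarrow> ennreal"
    and p1 p2 :: "'b \<Rightarrow> 'c"
    and \<nu> :: "'b measure"
  assumes three: "\<exists>x y w :: 'a. x \<noteq> y \<and> y \<noteq> w \<and> x \<noteq> w"
    and beta: "stone_cech_offdiag e"
    and unif: "samuel_compactification i"
    and Phi: "\<And>f. f \<in> Lip0 z0 \<Longrightarrow> continuous_on UNIV (Phi f) \<and>
                 (\<forall>x y. x \<noteq> y \<longrightarrow> Phi f (e (x, y)) = (f x - f y) / dist x y)"
    and dbar: "continuous_on UNIV dbar" "\<And>x y. x \<noteq> y \<Longrightarrow> dbar (e (x, y)) = ennreal (dist x y)"
    and d0bar: "continuous_on UNIV d0bar" "\<And>x. d0bar (i x) = ennreal (dist x z0)"
    and p: "continuous_on UNIV p1" "continuous_on UNIV p2"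
           "\<And>x y. x \<noteq> y \<Longrightarrow> p1 (e (x, y)) = i x" "\<And>x y. x \<noteq> y \<Longrightarrow> p2 (e (x, y)) = i y"
    and nu: "radon \<nu>" "mnorm \<nu> = PhiStar_norm z0 Phi \<nu>"
  shows "\<exists>\<mu>. radon \<mu> \<and> mnorm \<mu> = PhiStar_norm z0 Phi \<mu> \<and>
     (\<forall>f \<in> Lip0 z0. integral\<^sup>L \<mu> (Phi f) = integral\<^sup>L \<nu> (Phi f)) \<and>
     (\<forall>C \<in> frakC e. concentrated_on \<nu> C \<longrightarrow> concentrated_on \<mu> C) \<and>
     (\<forall>A. A \<in> sets borel \<and> A \<subseteq> {\<xi>. d0bar \<xi> < \<infinity>} \<and>
        concentrated_on \<nu>
          ({t. p1 t \<in> {\<xi>. d0bar \<xi> < \<infinity>} \<and> p2 t \<in> {\<xi>. d0bar \<xi> < \<infinity>}}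
           - {t. dbar t = 0 \<and> p1 t \<in> A \<and> p2 t \<in> A})
        \<longrightarrow> mutually_singular (restrict_to (distr \<mu> borel p1) A) (restrict_to (distr \<mu> borel p2) A))"
proof -
  interpret pair_compactification z0 e i dbar d0bar p1 p2
    by unfold_locales (fact three beta unif dbar d0bar p)+
  obtain \<mu> where \<mu>: "radon \<mu>" and le: "preceq e \<mu> \<nu>"
    and min: "\<And>\<epsilon>. 0 < \<epsilon> \<Longrightarrow> \<exists>g\<in>Gset e. (\<forall>z. 0 \<le> G0 z + g z) \<and> (\<integral>z. G0 z + g z \<partial>\<mu>) \<le> \<epsilon>"
    using G0_minimal_below[OF nu(1)] by blast
  interpret finite_measure \<mu> using \<mu> by (rule radonD)
  note [simp] = radonD(1,2)[OF \<mu>]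
  have Phi_eq: "integral\<^sup>L \<mu> (Phi f) = integral\<^sup>L \<nu> (Phi f)" if "f \<in> Lip0 z0" for f
  proof -
    have "Phi f \<in> Gset e" "(\<lambda>z. - Phi f z) \<in> Gset e"
      using Phi[OF that] Lip0_slope_in_Gset[of "Phi f" e f] by auto
    then have "integral\<^sup>L \<mu> (Phi f) \<le> integral\<^sup>L \<nu> (Phi f)"
      "(\<integral>z. - Phi f z \<partial>\<mu>) \<le> (\<integral>z. - Phi f z \<partial>\<nu>)"
      using le by (auto simp: preceq_def)
    then show ?thesis by simp
  qed
  have ball: "f \<in> Lip0 z0" if "f \<in> Lip0_ball z0" for f
    using that by (auto simp: Lip0_ball_def Lip0_def)
  \<comment> \<open>The circle of inequalities is \<mu>(1) \<le> \<nu>(1) = norm of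
    \<open>Phi\<close>-adjoint at \<nu> = the same at \<mu> \<le> \<mu>(1).\<close>
  have "mnorm \<mu> = PhiStar_norm z0 Phi \<mu>"
  proof (rule antisym)
    have "PhiStar_norm z0 Phi \<mu> = PhiStar_norm z0 Phi \<nu>"
      unfolding PhiStar_norm_def using Phi_eq ball by (intro arg_cong[of _ _ Sup] image_cong) auto
    then show "mnorm \<mu> \<le> PhiStar_norm z0 Phi \<mu>"
      using preceq_mnorm[OF \<mu> nu(1) le] nu(2) by simp
    show "PhiStar_norm z0 Phi \<mu> \<le> mnorm \<mu>"
      unfolding PhiStar_norm_def
    proof (rule cSup_least)
      have "(\<lambda>_. 0) \<in> Lip0_ball z0" by (auto simp: Lip0_ball_def intro!: lipschitz_onI)
      then show "(\<lambda>f. \<bar>integral\<^sup>L \<mu> (Phi f)\<bar>) ` Lip0_ball z0 \<noteq> {}" by blast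
      fix v assume "v \<in> (\<lambda>f. \<bar>integral\<^sup>L \<mu> (Phi f)\<bar>) ` Lip0_ball z0"
      then obtain f where f: "f \<in> Lip0_ball z0" and v: "v = \<bar>integral\<^sup>L \<mu> (Phi f)\<bar>" by blast
      have cPhi: "continuous_on UNIV (Phi f)"
        and Phi_pair: "\<And>x y. x \<noteq> y \<Longrightarrow> Phi f (e (x, y)) = (f x - f y) / dist x y"
        using Phi[OF ball[OF f]] by auto
      have "1-lipschitz_on UNIV f" using f by (simp add: Lip0_ball_def)
      then have "\<bar>f x - f y\<bar> \<le> dist x y" for x y
        using lipschitz_onD[of 1 UNIV f x y] by (simp add: dist_real_def)
      then have "\<bar>Phi f (e (x, y))\<bar> \<le> 1" if "x \<noteq> y" for x y
        using that by (simp add: Phi_pair abs_divide)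
      then have Phi_le: "\<bar>Phi f z\<bar> \<le> 1" for z
        using continuous_le[of "\<lambda>z. \<bar>Phi f z\<bar>" "\<lambda>_. 1"] cPhi by (simp add: continuous_on_rabs)
      have "v \<le> (\<integral>z. \<bar>Phi f z\<bar> \<partial>\<mu>)" unfolding v by (rule integral_abs_bound)
      also have "\<dots> \<le> (\<integral>z. 1 \<partial>\<mu>)"
        using Phi_le \<mu> cPhi
        by (intro integral_mono integrable_continuous continuous_on_rabs continuous_on_const) auto
      finally show "v \<le> mnorm \<mu>" by (simp add: mnorm_def)
    qed
  qed
  moreover have "concentrated_on \<mu> C" if "C \<in> frakC e" "concentrated_on \<nu> C" for C
    using that \<mu> nu(1) le by (auto simp: frakC_def)
  moreover have "mutually_singular (restrict_to (distr \<mu> borel p1) A) (restrict_to (distr \<mu> borel p2) A)"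
    if A: "A \<in> sets borel"
      and conc: "concentrated_on \<nu> ({t. p1 t \<in> {\<xi>. d0bar \<xi> < \<infinity>} \<and> p2 t \<in> {\<xi>. d0bar \<xi> < \<infinity>}}
           - {t. dbar t = 0 \<and> p1 t \<in> A \<and> p2 t \<in> A})" for A
  proof -
    obtain B where B: "B \<in> sets borel"
      and sing: "AE z in \<mu>. 0 < G0 z \<and> G0 z < 1 \<longrightarrow> p2 z \<in> B \<and> p1 z \<notin> B"
      using singular_coordinates[OF \<mu> min] .
    have conc': "AE z in \<nu>. d0bar (p1 z) < \<infinity> \<and> d0bar (p2 z) < \<infinity> \<and> \<not> (dbar z = 0 \<and> p1 z \<in> A \<and> p2 z \<in> A)"
      using conc by (simp add: concentrated_on_iff_AE)
    \<comment> \<open>Where d = 0 the two coordinates agree, so p1 z in A already puts z in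
      \<Delta>(A).\<close>
    then have "AE z in \<nu>. \<not> (dbar z = 0 \<and> p1 z \<in> A)"
      by eventually_elim (metis coordinates_eq_of_dbar_0)
    then have diag: "AE z in \<mu>. \<not> (dbar z = 0 \<and> p1 z \<in> A)"
      by (rule preceq_diagonal[OF \<mu> nu(1) le A])
    have "AE z in \<nu>. d0bar (p1 z) < \<infinity> \<and> d0bar (p2 z) < \<infinity>"
      using conc' by eventually_elim blast
    then have fin: "AE z in \<mu>. d0bar (p1 z) < \<infinity> \<and> d0bar (p2 z) < \<infinity>"
      by (rule preceq_concentrated_finite[OF \<mu> nu(1) le])
    \<comment> \<open>For 0 < d < \<infinity> the set B separates the coordinates. If d = 0, the
      common coordinate is outside A; the value d = \<infinity> is excluded by finiteness of both
      coordinates. Hence B is null for the first restricted marginal and its complement for the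
      second.\<close>
    have sep: "AE z in \<mu>. p1 z \<notin> A \<inter> B \<and> p2 z \<notin> A \<inter> (UNIV - B)"
      using sing diag fin
    proof eventually_elim
      case (elim z)
      have "G0 z \<noteq> 0" using dbar_finite[of z] elim(3) by (auto simp: G0_def recip_eq_0_iff)
      then have "0 < G0 z" using G0_nonneg[of z] by simp
      show ?case
      proof (cases "dbar z = 0")
        case True
        then show ?thesis using elim(2) coordinates_eq_of_dbar_0[OF True] by auto
      next
        case False
        then have "G0 z < 1" using recip_eq_1_iff[of "dbar z"] G0_le_1[of z] by (auto simp: G0_def)
        then show ?thesis using elim(1) \<open>0 < G0 z\<close> by blast
      qed
    qed
    have restrict: "emeasure (restrict_to (distr \<mu> borel q) A) X = emeasure \<mu> {z. q z \<in> A \<inter> X}"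
      if q: "continuous_on UNIV q" and X: "X \<in> sets borel" for q X
    proof -
      have "q \<in> \<mu> \<rightarrow>\<^sub>M borel" using borel_measurable_continuous_onI[OF q] by (simp cong: measurable_cong_sets)
      then show ?thesis
        unfolding restrict_to_def using A X
        by (subst emeasure_restricted) (auto simp: emeasure_distr vimage_def)
    qed
    have null: "emeasure \<mu> {z. q z \<in> A \<inter> X} = 0"
      if q: "continuous_on UNIV q" and X: "X \<in> sets borel" and ae: "AE z in \<mu>. q z \<notin> A \<inter> X" for q X
    proof -
      have "q -` (A \<inter> X) \<inter> space borel \<in> sets borel"
        using borel_measurable_continuous_onI[OF q] A X by (intro measurable_sets) auto
      then have "{z. q z \<in> A \<inter> X} \<in> sets \<mu>" by (simp add: vimage_def)
      then show ?thesis using ae by (simp add: AE_iff_measurable[OF _ refl])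
    qed
    have Bc: "UNIV - B \<in> sets borel" using B by (simp add: Compl_eq_Diff_UNIV[symmetric])
    have ae1: "AE z in \<mu>. p1 z \<notin> A \<inter> B" and ae2: "AE z in \<mu>. p2 z \<notin> A \<inter> (UNIV - B)"
      using sep by auto
    have "emeasure (restrict_to (distr \<mu> borel p1) A) B = 0"
      and "emeasure (restrict_to (distr \<mu> borel p2) A) (UNIV - B) = 0"
      unfolding restrict[OF p(1) B] restrict[OF p(2) Bc] by (rule null[OF p(1) B ae1], rule null[OF p(2) Bc ae2])
    then show ?thesis
      unfolding mutually_singular_def using B by (intro bexI[of _ B]) (auto simp: restrict_to_def)
  qed
  ultimately show ?thesis using \<mu> Phi_eq by blast
qed

end
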